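(* For every quantum channel $\mathcal{N}\colon A\to B$, $$\eta^{c}_D(\mathcal{N})=\eta_{\mathrm{2cqMIR}}(\mathcal{N})=\eta_{\mathrm{cqMIR}}(\mathcal{N})=\eta_{\mathrm{MIR}}(\mathcal{N}).$$
   Context: All systems are finite-dimensional. A channel on $A$ acts as the identity on other systems. $D(\rho\|\sigma)=\operatorname{Tr}[\rho(\log\rho-\log\sigma)]$ if $\operatorname{supp}(\rho)\subseteq\operatorname{supp}(\sigma)$, else $+\infty$; $I(A:B)=D(\rho_{AB}\|\rho_A\otimes\rho_B)$. In every ratio optimization, the supremum is over states for which the denominator is strictly positive and finite (coefficient $0$ if there are none). The complete contraction coefficient is $$\eta^{c}_D(\mathcal{N})=\sup_{R,\ \rho_{RA}\neq\sigma_{RA},\ \rho_R=\sigma_R}\frac{D(\mathcal{N}(\rho_{RA})\|\mathcal{N}(\sigma_{RA}))}{D(\rho_{RA}\|\sigma_{RA})},$$ over all finite-dimensional $R$. The coefficients of mutual information with reference are $$\eta_{\mathrm{MIR}}(\mathcal{N})=\sup_{\rho_{RCA}:\ \rho_{CR}=\rho_C\otimes\rho_R}\frac{I(C:BR)}{I(C:AR)},\qquad \eta_{\mathrm{cqMIR}}(\mathcal{N})=\sup_{\rho_{RUA}:\ \rho^u_R=\rho^v_R\ \forall u,v}\frac{I(U:BR)}{I(U:AR)},$$ $$\eta_{\mathrm{2cqMIR}}(\mathcal{N})=\sup_{\rho_{RUA}:\ |U|=2,\ \rho^0_R=\rho^1_R}\frac{I(U:BR)}{I(U:AR)},$$ where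 $R,C$ are arbitrary quantum systems, $U$ is classical with $\rho_{RUA}=\sum_u p(u)|u\rangle\langle u|_U\otimes\rho^u_{RA}$, numerators are evaluated after applying $\mathcal{N}$ to $A$, and denominators on the input state. *)

theory Defs
  imports
    "HOL-Library.Extended_Real"
    "Jordan_Normal_Form.Schur_Decomposition"
    "Jordan_Normal_Form.Matrix_Kernel"
begin

text \<open>
  A system is given by its dimension; operators on a d-dimensional system are complex
  \<open>d \<times> d\<close> matrices. On a composite system with factors of dimension \<open>a\<close> and \<open>b\<close> the basis
  vector \<open>|i\<rangle>|k\<rangle>\<close> has index \<open>i * b + k\<close>. With this convention
  \<open>((c, r), a)\<close> and \<open>(c, (r, a))\<close> index the same basis in the same order, so a matrix of
  size \<open>c * r * a = c * (r * a)\<close> can be read with either bipartition. The system the channel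
  acts on is always the last factor.
\<close>

definition mat_trace :: "complex mat \<Rightarrow> complex" where
  "mat_trace X = (\<Sum>i<dim_row X. X $$ (i, i))"

definition psd :: "nat \<Rightarrow> complex mat \<Rightarrow> bool" where
  "psd d X \<longleftrightarrow> X \<in> carrier_mat d d \<and> mat_adjoint X = X \<and>
     (\<forall>v \<in> carrier_vec d. 0 \<le> Re ((X *\<^sub>v v) \<bullet>c v))"

definition state :: "nat \<Rightarrow> complex mat \<Rightarrow> bool" where
  "state d \<rho> \<longleftrightarrow> psd d \<rho> \<and> mat_trace \<rho> = 1"

definition unitary_mat :: "nat \<Rightarrow> complex mat \<Rightarrow> bool" where
  "unitary_mat d U \<longleftrightarrow> U \<in> carrier_mat d d \<and> mat_adjoint U * U = 1\<^sub>m d"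

definition tensor_mat :: "complex mat \<Rightarrow> complex mat \<Rightarrow> complex mat" where
  "tensor_mat X Y = mat (dim_row X * dim_row Y) (dim_col X * dim_col Y)
     (\<lambda>(i, j). X $$ (i div dim_row Y, j div dim_col Y) * Y $$ (i mod dim_row Y, j mod dim_col Y))"

text \<open>Partial traces over the second and over the first factor of an \<open>a \<times> b\<close> system.\<close>

definition ptrace_snd :: "nat \<Rightarrow> nat \<Rightarrow> complex mat \<Rightarrow> complex mat" where
  "ptrace_snd a b X = mat a a (\<lambda>(i, j). \<Sum>k<b. X $$ (i * b + k, j * b + k))"

definition ptrace_fst :: "nat \<Rightarrow> nat \<Rightarrow> complex mat \<Rightarrow> complex mat" where
  "ptrace_fst a b X = mat b b (\<lambda>(k, l). \<Sum>i<a. X $$ (i * b + k, i * b + l))"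

text \<open>\<open>id \<otimes> N\<close> with an identity on an r-dimensional first factor: writing
  \<open>X = (\<Sum>i j. |i\<rangle>\<langle>j| \<otimes> X\<^sub>i\<^sub>j)\<close>, the result is \<open>(\<Sum>i j. |i\<rangle>\<langle>j| \<otimes> N X\<^sub>i\<^sub>j)\<close>.\<close>

definition id_tensor ::
    "nat \<Rightarrow> nat \<Rightarrow> nat \<Rightarrow> (complex mat \<Rightarrow> complex mat) \<Rightarrow> complex mat \<Rightarrow> complex mat" where
  "id_tensor r a b N X = mat (r * b) (r * b)
     (\<lambda>(i, j). N (mat a a (\<lambda>(k, l). X $$ ((i div b) * a + k, (j div b) * a + l)))
                 $$ (i mod b, j mod b))"

definition channel :: "nat \<Rightarrow> nat \<Rightarrow> (complex mat \<Rightarrow> complex mat) \<Rightarrow> bool" where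
  "channel a b N \<longleftrightarrow>
     (\<forall>X \<in> carrier_mat a a. N X \<in> carrier_mat b b) \<and>
     (\<forall>X \<in> carrier_mat a a. \<forall>Y \<in> carrier_mat a a. N (X + Y) = N X + N Y) \<and>
     (\<forall>c. \<forall>X \<in> carrier_mat a a. N (c \<cdot>\<^sub>m X) = c \<cdot>\<^sub>m N X) \<and>
     (\<forall>X \<in> carrier_mat a a. mat_trace (N X) = mat_trace X) \<and>
     (\<forall>r X. psd (r * a) X \<longrightarrow> psd (r * b) (id_tensor r a b N X))"

text \<open>Logarithm of a positive semidefinite matrix by spectral calculus, taken on its support
  and extended by \<open>0\<close> to its kernel. The result does not depend on the diagonalization.\<close>

definition mat_log :: "complex mat \<Rightarrow> complex mat" where
  "mat_log X = (THE L. \<exists>U (e :: nat \<Rightarrow> real).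
     unitary_mat (dim_row X) U \<and>
     X = U * mat_diag (dim_row X) (\<lambda>i. complex_of_real (e i)) * mat_adjoint U \<and>
     L = U * mat_diag (dim_row X) (\<lambda>i. complex_of_real (if e i > 0 then ln (e i) else 0))
           * mat_adjoint U)"

text \<open>The support is the orthogonal complement of the kernel.\<close>

definition mat_supp :: "complex mat \<Rightarrow> complex vec set" where
  "mat_supp X = {v \<in> carrier_vec (dim_col X). \<forall>w \<in> mat_kernel X. v \<bullet>c w = 0}"

definition rel_entropy :: "complex mat \<Rightarrow> complex mat \<Rightarrow> ereal" where
  "rel_entropy \<rho> \<sigma> =
     (if mat_supp \<rho> \<subseteq> mat_supp \<sigma>
      then ereal (Re (mat_trace (\<rho> * (mat_log \<rho> - mat_log \<sigma>)))) else \<infinity>)"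

definition mutual_info :: "nat \<Rightarrow> nat \<Rightarrow> complex mat \<Rightarrow> ereal" where
  "mutual_info a b \<rho> = rel_entropy \<rho> (tensor_mat (ptrace_snd a b \<rho>) (ptrace_fst a b \<rho>))"

text \<open>Supremum of the ratios of a set of (numerator, denominator) pairs, restricted to
  strictly positive finite denominators, and \<open>0\<close> if no pair qualifies
  (the supremum of the empty set in \<^typ>\<open>ereal\<close> would be \<open>- \<infinity>\<close>).\<close>

definition ratio_sup :: "(ereal \<times> ereal) set \<Rightarrow> ereal" where
  "ratio_sup S =
     (let Q = {x / y | x y. (x, y) \<in> S \<and> 0 < y \<and> y < \<infinity>} in if Q = {} then 0 else Sup Q)"

definition eta_complete :: "nat \<Rightarrow> nat \<Rightarrow> (complex mat \<Rightarrow> complex mat) \<Rightarrow> ereal" where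
  "eta_complete a b N = ratio_sup
     {(rel_entropy (id_tensor r a b N \<rho>) (id_tensor r a b N \<sigma>), rel_entropy \<rho> \<sigma>) | r \<rho> \<sigma>.
        state (r * a) \<rho> \<and> state (r * a) \<sigma> \<and> \<rho> \<noteq> \<sigma> \<and> ptrace_snd r a \<rho> = ptrace_snd r a \<sigma>}"

text \<open>The tripartite systems are ordered \<open>C, R, A\<close> and \<open>U, R, A\<close>.\<close>

definition eta_MIR :: "nat \<Rightarrow> nat \<Rightarrow> (complex mat \<Rightarrow> complex mat) \<Rightarrow> ereal" where
  "eta_MIR a b N = ratio_sup
     {(mutual_info c (r * b) (id_tensor (c * r) a b N \<rho>), mutual_info c (r * a) \<rho>) | c r \<rho>.
        state (c * r * a) \<rho> \<and>
        (let \<rho>CR = ptrace_snd (c * r) a \<rho>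
         in \<rho>CR = tensor_mat (ptrace_snd c r \<rho>CR) (ptrace_fst c r \<rho>CR))}"

definition basis_proj :: "nat \<Rightarrow> nat \<Rightarrow> complex mat" where
  "basis_proj n u = mat_diag n (\<lambda>i. if i = u then 1 else 0)"

text \<open>\<open>(\<Sum>u<n. p u |u\<rangle>\<langle>u| \<otimes> \<rho> u)\<close> for d-dimensional \<open>\<rho> u\<close>; the sum is written entrywise since
  matrices of unspecified size do not form a type-class monoid.\<close>

definition cq_state :: "nat \<Rightarrow> nat \<Rightarrow> (nat \<Rightarrow> real) \<Rightarrow> (nat \<Rightarrow> complex mat) \<Rightarrow> complex mat" where
  "cq_state n d p \<rho> = mat (n * d) (n * d)
     (\<lambda>ij. \<Sum>u<n. complex_of_real (p u) * tensor_mat (basis_proj n u) (\<rho> u) $$ ij)"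

definition prob_vec :: "nat \<Rightarrow> (nat \<Rightarrow> real) \<Rightarrow> bool" where
  "prob_vec n p \<longleftrightarrow> (\<forall>u<n. 0 \<le> p u) \<and> (\<Sum>u<n. p u) = 1"

text \<open>The pairs \<open>(I(U:BR), I(U:AR))\<close> with a classical system \<open>U\<close> of size \<open>n\<close>.\<close>

definition cq_pairs :: "nat \<Rightarrow> nat \<Rightarrow> nat \<Rightarrow> (complex mat \<Rightarrow> complex mat) \<Rightarrow> (ereal \<times> ereal) set" where
  "cq_pairs n a b N =
     {(mutual_info n (r * b) (id_tensor (n * r) a b N (cq_state n (r * a) p \<rho>)),
       mutual_info n (r * a) (cq_state n (r * a) p \<rho>)) | r p \<rho>.
        prob_vec n p \<and> (\<forall>u<n. state (r * a) (\<rho> u)) \<and>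
        (\<forall>u<n. \<forall>v<n. ptrace_snd r a (\<rho> u) = ptrace_snd r a (\<rho> v))}"

definition eta_cqMIR :: "nat \<Rightarrow> nat \<Rightarrow> (complex mat \<Rightarrow> complex mat) \<Rightarrow> ereal" where
  "eta_cqMIR a b N = ratio_sup (\<Union>n. cq_pairs n a b N)"

definition eta_2cqMIR :: "nat \<Rightarrow> nat \<Rightarrow> (complex mat \<Rightarrow> complex mat) \<Rightarrow> ereal" where
  "eta_2cqMIR a b N = ratio_sup (cq_pairs 2 a b N)"

end

(* Writing "<=" for inclusion of the sets of admissible ratios, 2cq <= cq <= MIR holds because a
   classical-quantum state with equal reference marginals has a product marginal on UR, and
   MIR <= complete holds because I(C:AR) is the relative entropy from rho_CRA to
   rho_C (x) rho_RA, two states with the same marginal on the reference CR.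

   Conversely, given rho and sigma with equal reference marginals, mix them by a bit U with
   weights t and 1 - t and let omega be the average. Donald's identity gives
     I(U:AR) = t D(rho||sigma) - D(omega||sigma),
   and the last term lies between 0 and O(t^2): both bounds follow from 1 - 1/x <= ln x <= x - 1
   applied to the doubly stochastic matrix of squared overlaps of the eigenbases of omega and sigma.
   The same holds after the channel, because rho <= c sigma is preserved by it. Hence the ratio of
   mutual informations tends to the ratio of relative entropies as t tends to 0. *)

theory Submission
  imports Defs "Jordan_Normal_Form.Spectral_Radius"
begin

section \<open>Adjoints, traces and unitaries\<close>

text \<open>The weight \<open>t\<close> sits on \<rho>, so the average is \<sigma> + t (\<rho> -
  \<sigma>). In the chi-square bound relative to \<sigma> the part linear in \<open>t\<close> is the
  trace of \<rho> - \<sigma>, which is 0; this is why the correction in Donald's identity is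
  quadratic and disappears after division by \<open>t\<close> while the main term stays. Singular
  states are the obstacle. The logarithm is 0 on the kernel, so scalar rules such as ln (c x) = ln c
  + ln x break at x = 0. Each time the inclusion of the kernel of \<sigma> in that of \<rho>, which
  a finite relative entropy provides, makes the offending weight vanish. In finite dimension this
  inclusion amounts to \<rho> \<le> c \<sigma> for some c, the form in which complete positivity
  carries it to the outputs. The limit shows only that a ratio of relative entropies is approached
  by binary ratios, so the return from the complete coefficient compares suprema and not sets.
  Because of the default value 0 it must also provide a binary ratio whenever a complete one
  exists.\<close>

lemma dim_mat_adjoint [simp]:
  "dim_row (mat_adjoint A) = dim_col A" "dim_col (mat_adjoint A) = dim_row A"
  by (auto simp: mat_adjoint_def)

lemma mat_adjoint_carrier [simp]:
  "A \<in> carrier_mat n m \<Longrightarrow> mat_adjoint A \<in> carrier_mat m n"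
  by (auto intro!: carrier_matI)

lemma mat_adjoint_index [simp]:
  fixes A :: "complex mat"
  assumes "i < dim_col A" "j < dim_row A"
  shows "mat_adjoint A $$ (i, j) = cnj (A $$ (j, i))"
  using assms by (auto simp: mat_adjoint_def mat_of_rows_def)

lemma index_mult_mat_sum:
  assumes "A \<in> carrier_mat n m" "B \<in> carrier_mat m p" "i < n" "j < p"
  shows "(A * B) $$ (i, j) = (\<Sum>k<m. A $$ (i, k) * B $$ (k, j))"
  using assms by (auto simp: scalar_prod_def atLeast0LessThan intro!: sum.cong)

text \<open>Associativity of matrix products carries dimension conditions, so the rewrite rule is
  fixed to one dimension \<open>d\<close> and bundled with closure of square matrices under
  products.\<close>

lemmas square_mat_assoc = assoc_mult_mat[of _ d d _ d _ d] mult_carrier_mat[of _ d d _ d] for d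

lemma mat_adjoint_mult:
  fixes A B :: "complex mat"
  assumes "A \<in> carrier_mat n m" "B \<in> carrier_mat m p"
  shows "mat_adjoint (A * B) = mat_adjoint B * mat_adjoint A"
proof (rule eq_matI)
  fix i j assume ij: "i < dim_row (mat_adjoint B * mat_adjoint A)" "j < dim_col (mat_adjoint B * mat_adjoint A)"
  then have ij: "i < p" "j < n" using assms by auto
  have "mat_adjoint (A * B) $$ (i, j) = cnj (\<Sum>k<m. A $$ (j, k) * B $$ (k, i))"
    using assms ij by (simp del: index_mult_mat(1) add: index_mult_mat_sum[of _ n m _ p])
  also have "\<dots> = (\<Sum>k<m. mat_adjoint B $$ (i, k) * mat_adjoint A $$ (k, j))"
    using assms ij by (auto intro!: sum.cong simp: mult.commute)
  also have "\<dots> = (mat_adjoint B * mat_adjoint A) $$ (i, j)"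
    using assms ij by (subst index_mult_mat_sum[of _ p m _ n]) auto
  finally show "mat_adjoint (A * B) $$ (i, j) = (mat_adjoint B * mat_adjoint A) $$ (i, j)" .
qed (use assms in auto)

lemma mat_adjoint_adjoint [simp]: "mat_adjoint (mat_adjoint A) = (A :: complex mat)"
  by (rule eq_matI) auto

lemma mat_trace_carrier: "A \<in> carrier_mat n m \<Longrightarrow> mat_trace A = (\<Sum>i<n. A $$ (i, i))"
  by (auto simp: mat_trace_def)

lemma mat_trace_mult:
  assumes "A \<in> carrier_mat n m" "B \<in> carrier_mat m n"
  shows "mat_trace (A * B) = (\<Sum>i<n. \<Sum>j<m. A $$ (i, j) * B $$ (j, i))"
  using assms by (auto simp: mat_trace_carrier[of _ n n] index_mult_mat_sum[of _ n m _ n]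
      simp del: index_mult_mat(1) intro!: sum.cong)

lemma mat_trace_comm:
  assumes "A \<in> carrier_mat n m" "B \<in> carrier_mat m n"
  shows "mat_trace (A * B) = mat_trace (B * A)"
  using assms by (simp add: mat_trace_mult[of _ n m] mat_trace_mult[of _ m n] mult.commute
      sum.swap[of _ "{..<n}" "{..<m}"])

lemma mat_trace_add:
  "A \<in> carrier_mat n n \<Longrightarrow> B \<in> carrier_mat n n \<Longrightarrow> mat_trace (A + B) = mat_trace A + mat_trace B"
  by (auto simp: mat_trace_def sum.distrib)

lemma mat_trace_minus:
  "A \<in> carrier_mat n n \<Longrightarrow> B \<in> carrier_mat n n \<Longrightarrow> mat_trace (A - B) = mat_trace A - mat_trace B"
  by (auto simp: mat_trace_def sum_subtractf)

lemma mat_trace_smult: "A \<in> carrier_mat n n \<Longrightarrow> mat_trace (c \<cdot>\<^sub>m A) = c * mat_trace A"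
  by (auto simp: mat_trace_def sum_distrib_left)

text \<open>\<open>unitary_mat\<close> asks only for a left inverse; for square matrices a left
  inverse is also a right inverse.\<close>

lemma unitary_matD:
  assumes "unitary_mat d U"
  shows "U \<in> carrier_mat d d" "mat_adjoint U \<in> carrier_mat d d"
    "mat_adjoint U * U = 1\<^sub>m d" "U * mat_adjoint U = 1\<^sub>m d"
  using assms mat_mult_left_right_inverse[of "mat_adjoint U" d U]
  unfolding unitary_mat_def by auto

lemma unitary_mat_mult:
  assumes "unitary_mat d U" "unitary_mat d V"
  shows "unitary_mat d (U * V)"
proof -
  note u = unitary_matD[OF assms(1)] and v = unitary_matD[OF assms(2)]
  have "mat_adjoint (U * V) * (U * V) = mat_adjoint V * mat_adjoint U * (U * V)"
    using u v by (simp add: mat_adjoint_mult[of _ d d])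
  also have "\<dots> = mat_adjoint V * (mat_adjoint U * U) * V"
    using u(1,2) v(1,2) by (simp add: square_mat_assoc[where d = d])
  also have "\<dots> = 1\<^sub>m d" using u v by simp
  finally show ?thesis using u v by (auto simp: unitary_mat_def)
qed

lemma unitary_mat_adjoint:
  "unitary_mat d U \<Longrightarrow> unitary_mat d (mat_adjoint U)"
  unfolding unitary_mat_def[of d "mat_adjoint U"] mat_adjoint_adjoint
  by (intro conjI unitary_matD)

section \<open>Spectral theorem\<close>

text \<open>Complete \<open>v\<close> to a basis, orthogonalize by Gram-Schmidt, which leaves the
  head of the list unchanged, and normalize. The scalar \<open>c\<close> is the inverse norm of
  \<open>v\<close>; proportionality is enough because an eigenvector may be rescaled.\<close>

lemma unitary_first_column:
  assumes v: "v \<in> carrier_vec n" and v0: "v \<noteq> 0\<^sub>v n"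
  obtains W c where "unitary_mat n W" "\<And>i. i < n \<Longrightarrow> W $$ (i, 0) = c * v $ i"
proof -
  interpret cof_vec_space n "TYPE(complex)" .
  define b where "b = basis_completion v"
  define ws where "ws = gram_schmidt n b"
  define X where "X = mat_of_cols n ws"
  have n: "n \<noteq> 0" using v v0 by (intro notI) auto
  from basis_completion[OF v v0, folded b_def]
  have dist_b: "distinct b" and indep: "\<not> lin_dep (set b)" and b: "set b \<subseteq> carrier_vec n"
    and hdb: "hd b = v" and len_b: "length b = n" by auto
  from hdb len_b n obtain vs where bv: "b = v # vs" by (cases b) auto
  from gram_schmidt_result[OF b dist_b indep refl, folded ws_def]
  have ws: "set ws \<subseteq> carrier_vec n" "corthogonal ws" "length ws = n" by (auto simp: len_b)
  from gram_schmidt_hd[OF v, of vs, folded bv] have hdws: "hd ws = v" unfolding ws_def .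
  have wsc: "ws ! i \<in> carrier_vec n" if "i < n" for i using ws that by auto
  define N where "N i = (\<Sum>k<n. (cmod (ws ! i $ k))\<^sup>2)" for i
  have sp: "ws ! i \<bullet>c ws ! j = (\<Sum>k<n. ws ! i $ k * cnj (ws ! j $ k))" if "i < n" "j < n" for i j
    using wsc[OF that(1)] wsc[OF that(2)] by (auto simp: scalar_prod_def atLeast0LessThan intro!: sum.cong)
  have NN: "ws ! i \<bullet>c ws ! i = complex_of_real (N i)" if "i < n" for i
    unfolding sp[OF that that] N_def by (simp add: complex_mult_cnj cmod_power2)
  have N0: "N i > 0" if i: "i < n" for i
  proof -
    have "ws ! i \<bullet>c ws ! i \<noteq> 0" using corthogonalD[OF ws(2), of i i] i ws by auto
    then have "N i \<noteq> 0" using NN[OF i] by auto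
    moreover have "N i \<ge> 0" by (auto simp: N_def intro!: sum_nonneg)
    ultimately show ?thesis by simp
  qed
  define W where "W = mat n n (\<lambda>(i, j). ws ! j $ i / complex_of_real (sqrt (N j)))"
  have W: "W \<in> carrier_mat n n" by (auto simp: W_def)
  have "mat_adjoint W * W = 1\<^sub>m n"
  proof (rule eq_matI)
    fix i j assume "i < dim_row (1\<^sub>m n)" "j < dim_col (1\<^sub>m n)"
    then have ij: "i < n" "j < n" by auto
    have "(mat_adjoint W * W) $$ (i, j) = (\<Sum>k<n. cnj (W $$ (k, i)) * W $$ (k, j))"
      using W ij by (subst index_mult_mat_sum[of _ n n _ n]) (auto intro!: sum.cong)
    also have "\<dots> = (\<Sum>k<n. ws ! j $ k * cnj (ws ! i $ k)) / complex_of_real (sqrt (N i) * sqrt (N j))"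
      using ij by (auto simp: W_def sum_divide_distrib intro!: sum.cong)
    also have "\<dots> = (ws ! j \<bullet>c ws ! i) / complex_of_real (sqrt (N i) * sqrt (N j))"
      using sp[OF ij(2,1)] by simp
    also have "\<dots> = (1\<^sub>m n :: complex mat) $$ (i, j)"
    proof (cases "i = j")
      case True
      then show ?thesis using ij NN[OF ij(1)] N0[OF ij(1)] by simp
    next
      case False
      then show ?thesis using corthogonalD[OF ws(2), of j i] ij ws by simp
    qed
    finally show "(mat_adjoint W * W) $$ (i, j) = (1\<^sub>m n :: complex mat) $$ (i, j)" .
  qed (use W in auto)
  then have "unitary_mat n W" using W by (auto simp: unitary_mat_def)
  moreover have "ws ! 0 = v" using hdws ws n by (cases ws) auto
  then have "W $$ (i, 0) = (1 / complex_of_real (sqrt (N 0))) * v $ i" if "i < n" for i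
    using that n by (simp add: W_def)
  ultimately show thesis by (rule that)
qed

text \<open>Deflation by induction on the dimension: conjugating with a unitary whose first column
  is an eigenvector clears the first column outside the corner, Hermiticity clears the first row and
  makes the corner real, and the induction hypothesis diagonalizes the remaining block.\<close>

lemma hermitian_spectral:
  fixes A :: "complex mat"
  assumes "A \<in> carrier_mat n n" "mat_adjoint A = A"
  shows "\<exists>U (e :: nat \<Rightarrow> real). unitary_mat n U \<and>
    A = U * mat_diag n (\<lambda>i. complex_of_real (e i)) * mat_adjoint U"
  using assms
proof (induction n arbitrary: A)
  case 0
  then show ?case
    by (intro exI[of _ "1\<^sub>m 0"] exI) (auto simp: unitary_mat_def)
next
  case (Suc n)
  let ?m = "Suc n"
  note A = Suc.prems(1) and herm = Suc.prems(2)
  from spectrum_non_empty[OF A] obtain k where "eigenvalue A k"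
    by (auto simp: spectrum_def)
  then obtain v where "eigenvector A v k" by (auto simp: eigenvalue_def)
  then have v: "v \<in> carrier_vec ?m" "v \<noteq> 0\<^sub>v ?m" and ev: "A *\<^sub>v v = k \<cdot>\<^sub>v v"
    using A by (auto simp: eigenvector_def)
  from unitary_first_column[OF v] obtain W c where W: "unitary_mat ?m W"
    and Wc: "\<And>i. i < ?m \<Longrightarrow> W $$ (i, 0) = c * v $ i" by blast
  note Wd = unitary_matD[OF W]
  define B where "B = mat_adjoint W * A * W"
  have B: "B \<in> carrier_mat ?m ?m" using Wd A by (auto simp: B_def)
  have Bh: "mat_adjoint B = B"
    unfolding B_def using Wd A herm
    by (simp add: mat_adjoint_mult[of _ ?m ?m _ ?m] square_mat_assoc[where d = "?m"])
  have herm': "B $$ (j, i) = cnj (B $$ (i, j))" if "i < ?m" "j < ?m" for i j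
    using arg_cong[OF Bh, of "\<lambda>M. M $$ (j, i)"] B that by simp
  have AW: "(A * W) $$ (i, 0) = k * W $$ (i, 0)" if i: "i < ?m" for i
  proof -
    have "(A * W) $$ (i, 0) = (\<Sum>l<?m. A $$ (i, l) * (c * v $ l))"
      using A Wd i Wc by (subst index_mult_mat_sum[of _ ?m ?m _ ?m]) (auto intro!: sum.cong)
    also have "\<dots> = c * (\<Sum>l<?m. A $$ (i, l) * v $ l)"
      by (simp add: sum_distrib_left mult_ac del: sum.lessThan_Suc)
    also have "(\<Sum>l<?m. A $$ (i, l) * v $ l) = (A *\<^sub>v v) $ i"
      using A v i by (auto simp: scalar_prod_def atLeast0LessThan intro!: sum.cong)
    also have "\<dots> = k * v $ i" using ev v i by simp
    finally show ?thesis using Wc[OF i] by simp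
  qed
  have B0: "B $$ (i, 0) = (if i = 0 then k else 0)" if i: "i < ?m" for i
  proof -
    have "B = mat_adjoint W * (A * W)" unfolding B_def using Wd A
      by (simp add: square_mat_assoc[where d = "?m"])
    then have "B $$ (i, 0) = (\<Sum>l<?m. mat_adjoint W $$ (i, l) * (k * W $$ (l, 0)))"
      using A Wd i AW by (simp del: index_mult_mat(1) add: index_mult_mat_sum[of _ ?m ?m _ ?m])
    also have "\<dots> = k * (mat_adjoint W * W) $$ (i, 0)"
      using Wd i by (subst index_mult_mat_sum[of _ ?m ?m _ ?m])
        (auto simp del: sum.lessThan_Suc simp add: sum_distrib_left mult_ac intro!: sum.cong)
    finally show ?thesis using i Wd(3) by simp
  qed
  have B0': "B $$ (0, i) = (if i = 0 then k else 0)" if i: "i < ?m" for i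
  proof (cases "i = 0")
    case False
    have "B $$ (0, i) = cnj (B $$ (i, 0))" by (rule herm'[OF i]) simp
    then show ?thesis using B0[OF i] False by simp
  qed (use B0[OF i] in simp)
  have kr: "k = complex_of_real (Re k)"
  proof -
    have "B $$ (0, 0) = cnj (B $$ (0, 0))" by (rule herm') simp_all
    then have "cnj k = k" by (metis B0 zero_less_Suc)
    then show ?thesis by (simp add: complex_eq_iff)
  qed
  define A' where "A' = mat n n (\<lambda>(i, j). B $$ (Suc i, Suc j))"
  have "mat_adjoint A' = A'"
    by (rule eq_matI) (auto simp: A'_def herm'[symmetric])
  then obtain U' e' where U': "unitary_mat n U'"
    and A'e: "A' = U' * mat_diag n (\<lambda>i. complex_of_real (e' i)) * mat_adjoint U'"
    using Suc.IH[of A'] by (auto simp: A'_def)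
  note Ud = unitary_matD[OF U']
  \<comment> \<open>Index 0 carries the new eigenvalue; the eigenvalues of the smaller block move up
    by one.\<close>
  define e where "e = case_nat (Re k) e'"
  define X where "X = four_block_mat (1\<^sub>m 1) (0\<^sub>m 1 n) (0\<^sub>m n 1) U'"
  have X: "X \<in> carrier_mat ?m ?m" using Ud four_block_carrier_mat[of "1\<^sub>m 1" 1 1 U' n n] by (auto simp: X_def)
  have Xa: "mat_adjoint X = four_block_mat (1\<^sub>m 1) (0\<^sub>m 1 n) (0\<^sub>m n 1) (mat_adjoint U')"
    by (rule eq_matI) (use Ud in \<open>auto simp: X_def\<close>)
  have De: "mat_diag ?m (\<lambda>i. complex_of_real (e i)) =
      four_block_mat (k \<cdot>\<^sub>m 1\<^sub>m 1) (0\<^sub>m 1 n) (0\<^sub>m n 1) (mat_diag n (\<lambda>i. complex_of_real (e' i)))"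
    by (rule eq_matI) (use kr in \<open>auto simp: e_def mat_diag_def split: nat.split\<close>)
  have BB: "B = four_block_mat (k \<cdot>\<^sub>m 1\<^sub>m 1) (0\<^sub>m 1 n) (0\<^sub>m n 1) A'"
    by (rule eq_matI) (use B B0 B0' in \<open>auto simp: A'_def\<close>)
  have "mat_adjoint X * X = 1\<^sub>m ?m"
  proof -
    have "mat_adjoint X * X = four_block_mat (1\<^sub>m 1) (0\<^sub>m 1 n) (0\<^sub>m n 1) (1\<^sub>m n)"
      unfolding Xa unfolding X_def
      using Ud by (subst mult_four_block_mat[of _ 1 1 _ n _ n _ _ 1 _ n]) auto
    also have "\<dots> = 1\<^sub>m ?m" by (rule eq_matI) auto
    finally show ?thesis .
  qed
  then have uX: "unitary_mat ?m X" using X by (auto simp: unitary_mat_def)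
  have BX: "B = X * mat_diag ?m (\<lambda>i. complex_of_real (e i)) * mat_adjoint X"
  proof -
    have "X * mat_diag ?m (\<lambda>i. complex_of_real (e i)) =
      four_block_mat (k \<cdot>\<^sub>m 1\<^sub>m 1) (0\<^sub>m 1 n) (0\<^sub>m n 1) (U' * mat_diag n (\<lambda>i. complex_of_real (e' i)))"
      unfolding De X_def using Ud
      by (subst mult_four_block_mat[of _ 1 1 _ n _ n _ _ 1 _ n]) (auto simp: left_mult_zero_mat[of _ n n])
    then show ?thesis
      unfolding Xa BB A'e using Ud
      by (simp, subst mult_four_block_mat[of _ 1 1 _ n _ n _ _ 1 _ n])
        (auto simp: left_mult_zero_mat[of _ n n] right_mult_zero_mat[of _ n n] mult_carrier_mat[of _ n n _ n])
  qed
  have "A = (W * mat_adjoint W) * A * (W * mat_adjoint W)" using Wd A by simp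
  also have "\<dots> = W * B * mat_adjoint W" unfolding B_def using Wd(1,2) A
    by (simp add: square_mat_assoc[where d = "?m"])
  also have "\<dots> = (W * X) * mat_diag ?m (\<lambda>i. complex_of_real (e i)) * mat_adjoint (W * X)"
    unfolding BX using Wd(1,2) X mat_diag_dim[of ?m "\<lambda>i. complex_of_real (e i)"]
    by (simp add: square_mat_assoc[where d = "?m"] mat_adjoint_mult[of _ ?m ?m _ ?m])
  finally show ?case using unitary_mat_mult[OF W uX] by blast
qed

section \<open>Positive semidefinite matrices\<close>

lemma cscalar_prod_mult_mat_vec:
  fixes X :: "complex mat"
  assumes "X \<in> carrier_mat d d" "v \<in> carrier_vec d"
  shows "(X *\<^sub>v v) \<bullet>c v = (\<Sum>i<d. \<Sum>j<d. cnj (v $ i) * X $$ (i, j) * v $ j)"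
  using assms by (auto simp: scalar_prod_def atLeast0LessThan sum_distrib_left sum_distrib_right
      mult_ac intro!: sum.cong)

lemma mult_mat_vec_index_sum:
  assumes "X \<in> carrier_mat n d" "v \<in> carrier_vec d" "i < n"
  shows "(X *\<^sub>v v) $ i = (\<Sum>j<d. X $$ (i, j) * v $ j)"
  using assms by (auto simp: scalar_prod_def atLeast0LessThan intro!: sum.cong)

text \<open>Test vectors become coefficient functions on indices, so that positivity arguments turn
  into manipulations of finite sums without carrier conditions.\<close>

lemma psd_iff:
  "psd d X \<longleftrightarrow> X \<in> carrier_mat d d \<and> (\<forall>i<d. \<forall>j<d. X $$ (j, i) = cnj (X $$ (i, j))) \<and>
    (\<forall>f. 0 \<le> Re (\<Sum>i<d. \<Sum>j<d. cnj (f i) * X $$ (i, j) * f j))"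
proof (cases "X \<in> carrier_mat d d")
  case X: True
  have "mat_adjoint X = X \<longleftrightarrow> (\<forall>i<d. \<forall>j<d. X $$ (j, i) = cnj (X $$ (i, j)))"
  proof
    assume h: "mat_adjoint X = X"
    show "\<forall>i<d. \<forall>j<d. X $$ (j, i) = cnj (X $$ (i, j))"
    proof (intro allI impI)
      fix i j assume "i < d" "j < d"
      then show "X $$ (j, i) = cnj (X $$ (i, j))"
        using arg_cong[OF h, of "\<lambda>M. M $$ (j, i)"] X by simp
    qed
  next
    assume "\<forall>i<d. \<forall>j<d. X $$ (j, i) = cnj (X $$ (i, j))"
    then have h: "cnj (X $$ (i, j)) = X $$ (j, i)" if "i < d" "j < d" for i j
      using that by metis
    show "mat_adjoint X = X" by (rule eq_matI) (use X in \<open>auto simp: h\<close>)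
  qed
  moreover have "(\<forall>v \<in> carrier_vec d. 0 \<le> Re ((X *\<^sub>v v) \<bullet>c v)) \<longleftrightarrow>
    (\<forall>f. 0 \<le> Re (\<Sum>i<d. \<Sum>j<d. cnj (f i) * X $$ (i, j) * f j))" (is "?L = ?R")
  proof
    assume ?L
    show ?R
    proof
      fix f
      have "0 \<le> Re ((X *\<^sub>v vec d f) \<bullet>c vec d f)" using \<open>?L\<close> by auto
      also have "(X *\<^sub>v vec d f) \<bullet>c vec d f = (\<Sum>i<d. \<Sum>j<d. cnj (f i) * X $$ (i, j) * f j)"
        using X by (subst cscalar_prod_mult_mat_vec[of _ d]) auto
      finally show "0 \<le> Re (\<Sum>i<d. \<Sum>j<d. cnj (f i) * X $$ (i, j) * f j)" .
    qed
  next
    assume ?R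
    then show ?L using X cscalar_prod_mult_mat_vec[of X d] by auto
  qed
  ultimately show ?thesis by (simp add: psd_def)
qed (simp add: psd_def)

lemma psd_hermitian: "psd d X \<Longrightarrow> i < d \<Longrightarrow> j < d \<Longrightarrow> X $$ (j, i) = cnj (X $$ (i, j))"
  unfolding psd_iff by blast

lemma psd_quadratic_nonneg:
  "psd d X \<Longrightarrow> 0 \<le> Re (\<Sum>i<d. \<Sum>j<d. cnj (f i) * X $$ (i, j) * f j)"
  unfolding psd_iff by blast

lemma psd_carrier: "psd d X \<Longrightarrow> X \<in> carrier_mat d d"
  by (simp add: psd_def)

section \<open>Chosen diagonalizations with real eigenvalues\<close>

definition spectral_form :: "nat \<Rightarrow> complex mat \<Rightarrow> complex mat \<Rightarrow> (nat \<Rightarrow> real) \<Rightarrow> bool" where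
  "spectral_form d X U e \<longleftrightarrow> unitary_mat d U \<and>
     X = U * mat_diag d (\<lambda>i. complex_of_real (e i)) * mat_adjoint U"

lemma spectral_form_unitary: "spectral_form d X U e \<Longrightarrow> unitary_mat d U"
  by (simp add: spectral_form_def)

lemma spectral_form_carrier: "spectral_form d X U e \<Longrightarrow> X \<in> carrier_mat d d"
  using unitary_matD(1,2)[of d U] by (auto simp: spectral_form_def)

lemma conj_diag_index:
  assumes "U \<in> carrier_mat d d" "i < d" "j < d"
  shows "(U * mat_diag d f * mat_adjoint U) $$ (i, j) =
    (\<Sum>k<d. f k * (U $$ (i, k) * cnj (U $$ (j, k))))"
proof -
  have "(U * mat_diag d f * mat_adjoint U) $$ (i, j) =
      (\<Sum>k<d. (U * mat_diag d f) $$ (i, k) * mat_adjoint U $$ (k, j))"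
    by (rule index_mult_mat_sum[of _ d]) (use assms in auto)
  also have "\<dots> = (\<Sum>k<d. f k * (U $$ (i, k) * cnj (U $$ (j, k))))"
    using assms by (auto simp: mat_diag_mult_right[of U d d] mult_ac intro!: sum.cong)
  finally show ?thesis .
qed

lemma spectral_form_index:
  assumes "spectral_form d X U e" "i < d" "j < d"
  shows "X $$ (i, j) = (\<Sum>k<d. complex_of_real (e k) * (U $$ (i, k) * cnj (U $$ (j, k))))"
  using assms conj_diag_index[of U d i j] unitary_matD(1)[of d U] by (simp add: spectral_form_def)

lemma unitary_col_orthonormal:
  assumes "unitary_mat d U" "i < d" "j < d"
  shows "(\<Sum>k<d. cnj (U $$ (k, i)) * U $$ (k, j)) = (if i = j then 1 else 0)"
proof -
  note u = unitary_matD[OF assms(1)]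
  have "(mat_adjoint U * U) $$ (i, j) = (\<Sum>k<d. cnj (U $$ (k, i)) * U $$ (k, j))"
    using u assms by (subst index_mult_mat_sum[of _ d d _ d]) (auto intro!: sum.cong)
  then show ?thesis using u assms by simp
qed

text \<open>Passing to the coordinates of \<open>f\<close> in the eigenbasis, called
  \<open>y\<close> in the proof, diagonalizes the form.\<close>

lemma spectral_form_quadratic:
  assumes "spectral_form d X U e"
  shows "(\<Sum>i<d. \<Sum>j<d. cnj (f i) * X $$ (i, j) * f j) =
    complex_of_real (\<Sum>k<d. e k * (cmod (\<Sum>i<d. cnj (U $$ (i, k)) * f i))\<^sup>2)"
proof -
  define y where "y k = (\<Sum>i<d. cnj (U $$ (i, k)) * f i)" for k
  have "(\<Sum>i<d. \<Sum>j<d. cnj (f i) * X $$ (i, j) * f j) =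
     (\<Sum>i<d. \<Sum>j<d. \<Sum>k<d. complex_of_real (e k) * ((U $$ (i, k) * cnj (f i)) * (cnj (U $$ (j, k)) * f j)))"
    by (auto simp: spectral_form_index[OF assms] sum_distrib_left sum_distrib_right mult_ac intro!: sum.cong)
  also have "\<dots> = (\<Sum>i<d. \<Sum>k<d. \<Sum>j<d. complex_of_real (e k) * ((U $$ (i, k) * cnj (f i)) * (cnj (U $$ (j, k)) * f j)))"
    by (intro sum.cong refl sum.swap)
  also have "\<dots> = (\<Sum>k<d. \<Sum>i<d. \<Sum>j<d. complex_of_real (e k) * ((U $$ (i, k) * cnj (f i)) * (cnj (U $$ (j, k)) * f j)))"
    by (rule sum.swap)
  also have "\<dots> = (\<Sum>k<d. complex_of_real (e k) * (cnj (y k) * y k))"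
    unfolding y_def cnj_sum sum_product
    by (auto simp: sum_distrib_left intro!: sum.cong)
  also have "\<dots> = complex_of_real (\<Sum>k<d. e k * (cmod (y k))\<^sup>2)"
    by (simp add: complex_norm_square mult.commute[of "cnj _"] flip: of_real_power)
  finally show ?thesis by (simp add: y_def)
qed

lemma psd_spectral_formI:
  assumes "spectral_form d X U e" "\<And>i. i < d \<Longrightarrow> 0 \<le> e i"
  shows "psd d X"
  unfolding psd_iff spectral_form_quadratic[OF assms(1)]
  using spectral_form_carrier[OF assms(1)] assms(2)
  by (auto simp: spectral_form_index[OF assms(1)] mult_ac intro!: sum_nonneg)

text \<open>The quadratic form takes the value \<open>e m\<close> at the eigenvector in column
  \<open>m\<close>, by orthonormality of the columns.\<close>

lemma psd_spectral_form_nonneg: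
  assumes "psd d X" "spectral_form d X U e" "m < d"
  shows "0 \<le> e m"
proof -
  have "0 \<le> Re (\<Sum>i<d. \<Sum>j<d. cnj (U $$ (i, m)) * X $$ (i, j) * U $$ (j, m))"
    by (rule psd_quadratic_nonneg[OF assms(1)])
  also have "\<dots> = (\<Sum>k<d. e k * (cmod (if k = m then 1 else 0))\<^sup>2)"
    unfolding spectral_form_quadratic[OF assms(2)]
    using unitary_col_orthonormal[OF spectral_form_unitary[OF assms(2)] _ assms(3)] by simp
  also have "\<dots> = (\<Sum>k<d. if k = m then e k else 0)" by (intro sum.cong) auto
  also have "\<dots> = e m" using assms(3) by simp
  finally show ?thesis .
qed

lemma psd_spectral_form:
  assumes "psd d X"
  obtains U e where "spectral_form d X U e" "\<And>i. i < d \<Longrightarrow> 0 \<le> e i"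
proof -
  from assms obtain U e where s: "spectral_form d X U e"
    using hermitian_spectral[of X d] by (auto simp: psd_def spectral_form_def)
  then show thesis using psd_spectral_form_nonneg[OF assms s] that by blast
qed

lemma spectral_form_mult_col:
  assumes s: "spectral_form d X U e" and j: "j < d"
  shows "X *\<^sub>v col U j = complex_of_real (e j) \<cdot>\<^sub>v col U j"
proof (rule eq_vecI)
  note u = unitary_matD[OF spectral_form_unitary[OF s]]
  note X = spectral_form_carrier[OF s]
  fix i assume "i < dim_vec (complex_of_real (e j) \<cdot>\<^sub>v col U j)"
  then have i: "i < d" using u by auto
  have "(X *\<^sub>v col U j) $ i = (\<Sum>l<d. X $$ (i, l) * U $$ (l, j))"
    using X u i j by (subst mult_mat_vec_index_sum[of _ d d]) (auto intro!: sum.cong)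
  also have "\<dots> = (X * U) $$ (i, j)" using X u i j by (subst index_mult_mat_sum[of _ d d _ d]) auto
  also have "X * U = U * mat_diag d (\<lambda>i. complex_of_real (e i)) * (mat_adjoint U * U)"
    using s u(1,2) by (simp add: spectral_form_def square_mat_assoc[where d = d])
  also have "\<dots> = U * mat_diag d (\<lambda>i. complex_of_real (e i))"
    using u by (auto intro!: right_mult_one_mat mult_carrier_mat)
  also have "\<dots> $$ (i, j) = (complex_of_real (e j) \<cdot>\<^sub>v col U j) $ i"
    using u i j by (simp add: mat_diag_mult_right[of U d d])
  finally show "(X *\<^sub>v col U j) $ i = (complex_of_real (e j) \<cdot>\<^sub>v col U j) $ i" .
qed (use spectral_form_carrier[OF s] unitary_matD[OF spectral_form_unitary[OF s]] in auto)

text \<open>In the eigenbasis the form is a sum of nonnegative terms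
  \<open>e k * (cmod (y k))\<^sup>2\<close>. If it vanishes, so does every \<open>e k * y k\<close>,
  and these are the coordinates of \<open>X\<close> applied to \<open>f\<close>.\<close>

lemma psd_quadratic_zero:
  assumes X: "psd d X" and z: "Re (\<Sum>i<d. \<Sum>j<d. cnj (f i) * X $$ (i, j) * f j) = 0" and i: "i < d"
  shows "(\<Sum>j<d. X $$ (i, j) * f j) = 0"
proof -
  obtain U e where s: "spectral_form d X U e" and e: "\<And>i. i < d \<Longrightarrow> 0 \<le> e i"
    using psd_spectral_form[OF X] by blast
  define y where "y k = (\<Sum>i<d. cnj (U $$ (i, k)) * f i)" for k
  have "(\<Sum>k<d. e k * (cmod (y k))\<^sup>2) = 0"
    using z unfolding spectral_form_quadratic[OF s] y_def by simp
  then have "\<forall>k<d. e k * (cmod (y k))\<^sup>2 = 0"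
    using e by (subst (asm) sum_nonneg_eq_0_iff) auto
  then have k0: "e k * y k = 0" if "k < d" for k using that by auto
  have "(\<Sum>j<d. X $$ (i, j) * f j) =
     (\<Sum>j<d. \<Sum>k<d. U $$ (i, k) * (e k * (cnj (U $$ (j, k)) * f j)))"
    using i by (auto simp: spectral_form_index[OF s] sum_distrib_left sum_distrib_right mult_ac intro!: sum.cong)
  also have "\<dots> = (\<Sum>k<d. \<Sum>j<d. U $$ (i, k) * (e k * (cnj (U $$ (j, k)) * f j)))"
    by (rule sum.swap)
  also have "\<dots> = (\<Sum>k<d. U $$ (i, k) * (e k * y k))"
    by (simp add: y_def sum_distrib_left)
  also have "\<dots> = 0" using k0 by (intro sum.neutral) auto
  finally show ?thesis .
qed

section \<open>Kernels, supports and domination by a multiple\<close>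

lemma mat_kernel_iff:
  assumes "X \<in> carrier_mat d d"
  shows "v \<in> mat_kernel X \<longleftrightarrow> v \<in> carrier_vec d \<and> (\<forall>i<d. (\<Sum>j<d. X $$ (i, j) * v $ j) = 0)"
  using assms by (auto simp: mat_kernel_def vec_eq_iff simp del: index_mult_mat_vec
      simp flip: mult_mat_vec_index_sum[of X d d])

lemma psd_mat_kernel_iff:
  assumes "psd d X"
  shows "v \<in> mat_kernel X \<longleftrightarrow>
    v \<in> carrier_vec d \<and> Re (\<Sum>i<d. \<Sum>j<d. cnj (v $ i) * X $$ (i, j) * v $ j) = 0"
proof -
  have "(\<Sum>i<d. \<Sum>j<d. cnj (v $ i) * X $$ (i, j) * v $ j) =
      (\<Sum>i<d. cnj (v $ i) * (\<Sum>j<d. X $$ (i, j) * v $ j))"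
    by (simp add: sum_distrib_left mult_ac)
  then have "Re (\<Sum>i<d. \<Sum>j<d. cnj (v $ i) * X $$ (i, j) * v $ j) = 0"
    if "\<forall>i<d. (\<Sum>j<d. X $$ (i, j) * v $ j) = 0"
    using that by simp
  then show ?thesis
    unfolding mat_kernel_iff[OF psd_carrier[OF assms]]
    using psd_quadratic_zero[OF assms, of "\<lambda>i. v $ i"] by blast
qed

lemma mat_supp_mono:
  assumes "dim_col \<rho> = dim_col \<sigma>" "mat_kernel \<sigma> \<subseteq> mat_kernel \<rho>"
  shows "mat_supp \<rho> \<subseteq> mat_supp \<sigma>"
  using assms by (auto simp: mat_supp_def)

text \<open>Eigenvectors of \<rho> with nonzero eigenvalue are orthogonal to its kernel by
  Hermiticity, hence lie in its support and so in that of \<sigma>. A kernel vector of \<sigma> is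
  orthogonal to all of them, so the form of \<rho> vanishes on it.\<close>

lemma mat_kernel_mono_of_supp:
  assumes r: "psd d \<rho>" and s: "psd d \<sigma>" and supp: "mat_supp \<rho> \<subseteq> mat_supp \<sigma>"
  shows "mat_kernel \<sigma> \<subseteq> mat_kernel \<rho>"
proof
  fix v assume v: "v \<in> mat_kernel \<sigma>"
  have R: "\<rho> \<in> carrier_mat d d" and S: "\<sigma> \<in> carrier_mat d d" using r s by (auto simp: psd_def)
  have vc: "v \<in> carrier_vec d" using v S by (auto simp: mat_kernel_def)
  obtain U e where sf: "spectral_form d \<rho> U e" and e: "\<And>i. i < d \<Longrightarrow> 0 \<le> e i"
    using psd_spectral_form[OF r] by blast
  note u = unitary_matD[OF spectral_form_unitary[OF sf]]
  have herm: "\<rho> $$ (j, i) = cnj (\<rho> $$ (i, j))" if "i < d" "j < d" for i j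
    by (rule psd_hermitian[OF r that])
  have *: "(\<Sum>i<d. cnj (U $$ (i, k)) * v $ i) = 0" if k: "k < d" and ek: "e k \<noteq> 0" for k
  proof -
    have "col U k \<in> mat_supp \<rho>"
      unfolding mat_supp_def
    proof (intro CollectI conjI ballI)
      show "col U k \<in> carrier_vec (dim_col \<rho>)" using R u by auto
      fix w assume "w \<in> mat_kernel \<rho>"
      then have w: "w \<in> carrier_vec d" "\<And>i. i < d \<Longrightarrow> (\<Sum>j<d. \<rho> $$ (i, j) * w $ j) = 0"
        unfolding mat_kernel_iff[OF R] by auto
      have "complex_of_real (e k) * (col U k \<bullet>c w) = (complex_of_real (e k) \<cdot>\<^sub>v col U k) \<bullet>c w"
        using u w by (simp add: smult_scalar_prod_distrib[of _ d])
      also have "\<dots> = (\<rho> *\<^sub>v col U k) \<bullet>c w" by (simp add: spectral_form_mult_col[OF sf k])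
      also have "\<dots> = (\<Sum>i<d. (\<Sum>j<d. \<rho> $$ (i, j) * U $$ (j, k)) * cnj (w $ i))"
        using w R u k by (auto simp: scalar_prod_def atLeast0LessThan intro!: sum.cong)
      also have "\<dots> = (\<Sum>i<d. \<Sum>j<d. cnj (\<rho> $$ (j, i) * w $ i) * U $$ (j, k))"
        by (auto simp: sum_distrib_left sum_distrib_right mult_ac herm[symmetric] intro!: sum.cong)
      also have "\<dots> = (\<Sum>j<d. \<Sum>i<d. cnj (\<rho> $$ (j, i) * w $ i) * U $$ (j, k))"
        by (rule sum.swap)
      also have "\<dots> = (\<Sum>j<d. cnj (\<Sum>i<d. \<rho> $$ (j, i) * w $ i) * U $$ (j, k))"
        by (simp add: sum_distrib_right)
      also have "\<dots> = 0" using w by (intro sum.neutral) auto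
      finally show "col U k \<bullet>c w = 0" using ek by simp
    qed
    then have "col U k \<bullet>c v = 0" using supp v by (auto simp: mat_supp_def)
    then have "cnj (col U k \<bullet>c v) = 0" by simp
    then show ?thesis
      using u vc k by (simp add: scalar_prod_def atLeast0LessThan mult_ac)
  qed
  have "Re (\<Sum>i<d. \<Sum>j<d. cnj (v $ i) * \<rho> $$ (i, j) * v $ j) = 0"
    unfolding spectral_form_quadratic[OF sf] using * by (force intro!: sum.neutral)
  then show "v \<in> mat_kernel \<rho>" unfolding psd_mat_kernel_iff[OF r] using vc by simp
qed

text \<open>On a kernel vector \<open>v\<close> of \<sigma> the form of \<rho> is squeezed: 0 \<le>
  <v, \<rho> v> \<le> c <v, \<sigma> v> = 0.\<close>

lemma mat_kernel_mono_of_dominated: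
  assumes r: "psd d \<rho>" and s: "psd d \<sigma>" and dom: "psd d (complex_of_real c \<cdot>\<^sub>m \<sigma> - \<rho>)"
  shows "mat_kernel \<sigma> \<subseteq> mat_kernel \<rho>"
proof
  fix v assume v: "v \<in> mat_kernel \<sigma>"
  have R: "\<rho> \<in> carrier_mat d d" and S: "\<sigma> \<in> carrier_mat d d" using r s by (auto simp: psd_def)
  let ?q = "\<lambda>X. (\<Sum>i<d. \<Sum>j<d. cnj (v $ i) * X $$ (i, j) * v $ j)"
  have vc: "v \<in> carrier_vec d" and 0: "Re (?q \<sigma>) = 0" using v unfolding psd_mat_kernel_iff[OF s] by auto
  have "0 \<le> Re (?q (complex_of_real c \<cdot>\<^sub>m \<sigma> - \<rho>))" by (rule psd_quadratic_nonneg[OF dom])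
  also have "?q (complex_of_real c \<cdot>\<^sub>m \<sigma> - \<rho>) = complex_of_real c * ?q \<sigma> - ?q \<rho>"
    using R S by (simp add: sum_distrib_left algebra_simps sum_subtractf)
  finally have "Re (?q \<rho>) \<le> 0" using 0 by simp
  moreover have "0 \<le> Re (?q \<rho>)" by (rule psd_quadratic_nonneg[OF r])
  ultimately show "v \<in> mat_kernel \<rho>" unfolding psd_mat_kernel_iff[OF r] using vc by simp
qed

text \<open>Restricted to the eigenvectors of \<sigma> with positive eigenvalue, the form of
  \<sigma> is bounded below by the least such eigenvalue, and the form of \<rho> sees only these
  directions. This turns a statement on kernels into an operator inequality, which positive linear
  maps preserve.\<close>

lemma psd_dominated_of_kernel:
  assumes r: "psd d \<rho>" and s: "psd d \<sigma>" and ker: "mat_kernel \<sigma> \<subseteq> mat_kernel \<rho>"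
  obtains c where "psd d (complex_of_real c \<cdot>\<^sub>m \<sigma> - \<rho>)"
proof -
  have R: "\<rho> \<in> carrier_mat d d" and S: "\<sigma> \<in> carrier_mat d d" using r s by (auto simp: psd_def)
  obtain V e where sf: "spectral_form d \<sigma> V e" and e: "\<And>i. i < d \<Longrightarrow> 0 \<le> e i"
    using psd_spectral_form[OF s] by blast
  note V = unitary_matD[OF spectral_form_unitary[OF sf]]
  obtain W g where rf: "spectral_form d \<rho> W g" and g: "\<And>i. i < d \<Longrightarrow> 0 \<le> g i"
    using psd_spectral_form[OF r] by blast
  note W = unitary_matD[OF spectral_form_unitary[OF rf]]
  \<comment> \<open>A positive lower bound for the nonzero eigenvalues of \<sigma>; the inserted 1
    keeps the set nonempty when there are none.\<close>
  define m where "m = Min (insert 1 (e ` {i. i < d \<and> e i > 0}))"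
  have m: "m > 0" unfolding m_def by (subst Min_gr_iff) auto
  have me: "m \<le> e i" if "i < d" "e i > 0" for i
    unfolding m_def using that by (intro Min_le) auto
  define M where "M = mat_adjoint W * V"
  have M: "M \<in> carrier_mat d d" using V W by (auto simp: M_def)
  have MV: "W $$ (i, k) = (\<Sum>j<d. V $$ (i, j) * cnj (M $$ (k, j)))" if "i < d" "k < d" for i k
  proof -
    have "V * mat_adjoint M = V * (mat_adjoint V * W)" unfolding M_def
      using V W by (simp add: mat_adjoint_mult[of _ d d _ d])
    also have "\<dots> = (V * mat_adjoint V) * W" using V(1,2) W(1,2)
      by (simp add: square_mat_assoc[where d = d])
    also have "\<dots> = W" using V W by simp
    finally have "W $$ (i, k) = (V * mat_adjoint M) $$ (i, k)" by simp
    also have "\<dots> = (\<Sum>j<d. V $$ (i, j) * cnj (M $$ (k, j)))"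
      using V M that by (subst index_mult_mat_sum[of _ d d _ d]) (auto intro!: sum.cong)
    finally show ?thesis .
  qed
  \<comment> \<open>An eigenvector of \<sigma> for eigenvalue 0 lies in the kernel of \<rho>, so it
    is orthogonal to every eigenvector of \<rho> of nonzero eigenvalue.\<close>
  have Mz: "g k = 0 \<or> M $$ (k, j) = 0" if kj: "k < d" "j < d" and ej: "e j = 0" for k j
  proof -
    have "col V j \<in> mat_kernel \<sigma>"
      using spectral_form_mult_col[OF sf kj(2)] ej V S by (auto simp: mat_kernel_def)
    then have "Re (\<Sum>i<d. \<Sum>l<d. cnj (col V j $ i) * \<rho> $$ (i, l) * col V j $ l) = 0"
      using ker unfolding psd_mat_kernel_iff[OF r, symmetric] by (auto simp: psd_mat_kernel_iff[OF r])
    then have "(\<Sum>k<d. g k * (cmod (\<Sum>i<d. cnj (W $$ (i, k)) * col V j $ i))\<^sup>2) = 0"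
      unfolding spectral_form_quadratic[OF rf] by simp
    then have "g k * (cmod (\<Sum>i<d. cnj (W $$ (i, k)) * col V j $ i))\<^sup>2 = 0"
      using g kj by (subst (asm) sum_nonneg_eq_0_iff) auto
    moreover have "(\<Sum>i<d. cnj (W $$ (i, k)) * col V j $ i) = M $$ (k, j)"
      unfolding M_def using V W kj by (subst index_mult_mat_sum[of _ d d _ d]) (auto intro!: sum.cong)
    ultimately show ?thesis by auto
  qed
  \<comment> \<open>The constant produced by the triangle inequality. With \<open>Q\<close> the form
    of \<sigma>, each coordinate with \<open>e j \<noteq> 0\<close> has modulus at most
    \<open>sqrt (Q / m)\<close>, so the \<open>k\<close>-th coordinate in the eigenbasis of \<rho>,
    if \<open>g k \<noteq> 0\<close>, is at most the absolute row sum of \<open>M\<close> times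
    that.\<close>
  define c where "c = (\<Sum>k<d. g k * (\<Sum>j<d. cmod (M $$ (k, j)))\<^sup>2) / m"
  have bound: "(\<Sum>k<d. g k * (cmod (\<Sum>i<d. cnj (W $$ (i, k)) * f i))\<^sup>2) \<le>
      c * (\<Sum>k<d. e k * (cmod (\<Sum>i<d. cnj (V $$ (i, k)) * f i))\<^sup>2)" for f
  proof -
    define y where "y j = (\<Sum>i<d. cnj (V $$ (i, j)) * f i)" for j
    define Q where "Q = (\<Sum>k<d. e k * (cmod (y k))\<^sup>2)"
    have Q: "Q \<ge> 0" unfolding Q_def using e by (auto intro!: sum_nonneg)
    have yQ: "cmod (y j) \<le> sqrt (Q / m)" if j: "j < d" "e j \<noteq> 0" for j
    proof (rule real_le_rsqrt)
      have "m * (cmod (y j))\<^sup>2 \<le> e j * (cmod (y j))\<^sup>2"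
        using me[of j] e[of j] j by (intro mult_right_mono) auto
      also have "\<dots> \<le> Q" unfolding Q_def
        using e j by (intro member_le_sum) auto
      finally show "(cmod (y j))\<^sup>2 \<le> Q / m" using m by (simp add: field_simps)
    qed
    have Wy: "(\<Sum>i<d. cnj (W $$ (i, k)) * f i) = (\<Sum>j<d. M $$ (k, j) * y j)" if k: "k < d" for k
    proof -
      have "(\<Sum>i<d. cnj (W $$ (i, k)) * f i) = (\<Sum>i<d. \<Sum>j<d. M $$ (k, j) * (cnj (V $$ (i, j)) * f i))"
        using MV k by (auto simp: sum_distrib_left sum_distrib_right mult_ac intro!: sum.cong)
      also have "\<dots> = (\<Sum>j<d. \<Sum>i<d. M $$ (k, j) * (cnj (V $$ (i, j)) * f i))" by (rule sum.swap)
      finally show ?thesis by (simp add: y_def sum_distrib_left)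
    qed
    have summand: "g k * (cmod (\<Sum>i<d. cnj (W $$ (i, k)) * f i))\<^sup>2 \<le>
        g k * ((\<Sum>j<d. cmod (M $$ (k, j)))\<^sup>2 * (Q / m))" if k: "k < d" for k
    proof (cases "g k = 0")
      case False
      have "cmod (\<Sum>j<d. M $$ (k, j) * y j) \<le> (\<Sum>j<d. cmod (M $$ (k, j) * y j))" by (rule norm_sum)
      also have "\<dots> \<le> (\<Sum>j<d. cmod (M $$ (k, j)) * sqrt (Q / m))"
      proof (rule sum_mono)
        fix j assume "j \<in> {..<d}"
        then have j: "j < d" by simp
        show "cmod (M $$ (k, j) * y j) \<le> cmod (M $$ (k, j)) * sqrt (Q / m)"
          using yQ[OF j] Mz[OF k j] False
          by (cases "e j = 0") (auto simp: norm_mult intro!: mult_left_mono)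
      qed
      finally have "cmod (\<Sum>j<d. M $$ (k, j) * y j) \<le> (\<Sum>j<d. cmod (M $$ (k, j))) * sqrt (Q / m)"
        by (simp add: sum_distrib_right)
      then have "(cmod (\<Sum>j<d. M $$ (k, j) * y j))\<^sup>2 \<le> ((\<Sum>j<d. cmod (M $$ (k, j))) * sqrt (Q / m))\<^sup>2"
        by (intro power_mono) auto
      also have "\<dots> = (\<Sum>j<d. cmod (M $$ (k, j)))\<^sup>2 * (Q / m)"
        using Q m by (simp add: power_mult_distrib)
      finally show ?thesis using Wy[OF k] g[OF k] by (intro mult_left_mono) auto
    qed auto
    have "(\<Sum>k<d. g k * (cmod (\<Sum>i<d. cnj (W $$ (i, k)) * f i))\<^sup>2) \<le>
       (\<Sum>k<d. g k * ((\<Sum>j<d. cmod (M $$ (k, j)))\<^sup>2 * (Q / m)))"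
      by (intro sum_mono summand) auto
    also have "\<dots> = c * Q" by (simp add: c_def sum_distrib_left sum_distrib_right sum_divide_distrib mult_ac)
    finally show ?thesis by (simp add: Q_def y_def)
  qed
  have "psd d (complex_of_real c \<cdot>\<^sub>m \<sigma> - \<rho>)"
    unfolding psd_iff
  proof (intro conjI allI impI)
    fix f
    have "(\<Sum>i<d. \<Sum>j<d. cnj (f i) * (complex_of_real c \<cdot>\<^sub>m \<sigma> - \<rho>) $$ (i, j) * f j) =
      complex_of_real c * (\<Sum>i<d. \<Sum>j<d. cnj (f i) * \<sigma> $$ (i, j) * f j) - (\<Sum>i<d. \<Sum>j<d. cnj (f i) * \<rho> $$ (i, j) * f j)"
      using R S by (simp add: sum_distrib_left algebra_simps sum_subtractf)
    then show "0 \<le> Re (\<Sum>i<d. \<Sum>j<d. cnj (f i) * (complex_of_real c \<cdot>\<^sub>m \<sigma> - \<rho>) $$ (i, j) * f j)"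
      using bound[of f] by (simp add: spectral_form_quadratic[OF sf] spectral_form_quadratic[OF rf])
  next
    fix i j assume ij: "i < d" "j < d"
    then show "(complex_of_real c \<cdot>\<^sub>m \<sigma> - \<rho>) $$ (j, i) = cnj ((complex_of_real c \<cdot>\<^sub>m \<sigma> - \<rho>) $$ (i, j))"
      using psd_hermitian[OF r ij, symmetric] psd_hermitian[OF s ij, symmetric] R S by simp
  qed (use R S in auto)
  then show thesis by (rule that)
qed

section \<open>Logarithm and relative entropy in eigenbases\<close>

text \<open>The scalar function that \<open>mat_log\<close> applies to eigenvalues, named so that it
  can serve as the \<open>g\<close> of the spectral calculus.\<close>

definition ln0 :: "real \<Rightarrow> real" where
  "ln0 x = (if x > 0 then ln x else 0)"

lemma ln0_pos: "0 < x \<Longrightarrow> ln0 x = ln x"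
  by (simp add: ln0_def)

text \<open>The change of basis \<open>W\<close> intertwines the two diagonal matrices, so a nonzero
  entry \<open>W $$ (i, j)\<close> forces \<open>e j = f i\<close>. Hence it also intertwines their
  images under \<open>g\<close>. This makes the definite description in \<open>mat_log\<close> well
  defined.\<close>

lemma spectral_calculus_unique:
  assumes X: "spectral_form d X U e" and X': "spectral_form d X V f"
  shows "U * mat_diag d (\<lambda>i. complex_of_real (g (e i))) * mat_adjoint U =
         V * mat_diag d (\<lambda>i. complex_of_real (g (f i))) * mat_adjoint V"
proof -
  let ?D = "\<lambda>e. mat_diag d (\<lambda>i. complex_of_real (e i))"
  note u = unitary_matD[OF spectral_form_unitary[OF X]]
  note v = unitary_matD[OF spectral_form_unitary[OF X']]
  define W where "W = mat_adjoint V * U"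
  have W: "W \<in> carrier_mat d d" using u v by (auto simp: W_def)
  have "W * ?D e = mat_adjoint V * (U * ?D e * (mat_adjoint U * U))"
    unfolding W_def u(3) using u(1,2) v(1,2) by (simp add: square_mat_assoc[where d = d] right_mult_one_mat[of _ d d])
  also have "\<dots> = mat_adjoint V * (U * ?D e * mat_adjoint U) * U"
    using u(1,2) v(1,2) by (simp add: square_mat_assoc[where d = d])
  also have "U * ?D e * mat_adjoint U = V * ?D f * mat_adjoint V"
    using X X' by (simp add: spectral_form_def)
  also have "mat_adjoint V * (V * ?D f * mat_adjoint V) * U = (mat_adjoint V * V) * (?D f * W)"
    unfolding W_def using u(1,2) v(1,2) by (simp add: square_mat_assoc[where d = d])
  also have "\<dots> = ?D f * W" using v W by (simp add: left_mult_one_mat[of _ d d] mult_carrier_mat[of _ d d _ d])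
  finally have eq: "W * ?D e = ?D f * W" .
  have ent: "W $$ (i, j) * complex_of_real (e j) = complex_of_real (f i) * W $$ (i, j)"
    if "i < d" "j < d" for i j
    using arg_cong[OF eq, of "\<lambda>M. M $$ (i, j)"] that
    unfolding mat_diag_mult_left[OF W] mat_diag_mult_right[OF W] by simp
  have "W * ?D (\<lambda>i. g (e i)) = ?D (\<lambda>i. g (f i)) * W"
    unfolding mat_diag_mult_left[OF W] mat_diag_mult_right[OF W]
  proof (rule cong_mat, goal_cases)
    case (3 i j)
    show ?case using ent[OF 3] by (cases "W $$ (i, j) = 0") (auto simp: mult.commute)
  qed auto
  then have "V * (W * ?D (\<lambda>i. g (e i))) * mat_adjoint U = V * (?D (\<lambda>i. g (f i)) * W) * mat_adjoint U"
    by simp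
  then have "(V * mat_adjoint V) * (U * ?D (\<lambda>i. g (e i)) * mat_adjoint U) =
      V * ?D (\<lambda>i. g (f i)) * mat_adjoint V * (U * mat_adjoint U)"
    unfolding W_def using u(1,2) v(1,2) by (simp add: square_mat_assoc[where d = d])
  then show ?thesis unfolding u(4) v(4) using u(1,2) v(1,2)
    by (simp add: mult_carrier_mat[of _ d d _ d])
qed

lemma mat_log_spectral_form:
  assumes X: "spectral_form d X U e"
  shows "mat_log X = U * mat_diag d (\<lambda>i. complex_of_real (ln0 (e i))) * mat_adjoint U"
proof -
  have d: "dim_row X = d" using spectral_form_carrier[OF X] by simp
  show ?thesis
    unfolding mat_log_def d ln0_def[symmetric]
  proof (rule the_equality)
    show "\<exists>U' f. unitary_mat d U' \<and> X = U' * mat_diag d (\<lambda>i. complex_of_real (f i)) * mat_adjoint U' \<and>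
       U * mat_diag d (\<lambda>i. complex_of_real (ln0 (e i))) * mat_adjoint U =
       U' * mat_diag d (\<lambda>i. complex_of_real (ln0 (f i))) * mat_adjoint U'"
      using X by (auto simp: spectral_form_def)
  next
    fix L
    assume "\<exists>V f. unitary_mat d V \<and> X = V * mat_diag d (\<lambda>i. complex_of_real (f i)) * mat_adjoint V \<and>
       L = V * mat_diag d (\<lambda>i. complex_of_real (ln0 (f i))) * mat_adjoint V"
    then obtain V f where "spectral_form d X V f"
      and "L = V * mat_diag d (\<lambda>i. complex_of_real (ln0 (f i))) * mat_adjoint V"
      by (auto simp: spectral_form_def)
    then show "L = U * mat_diag d (\<lambda>i. complex_of_real (ln0 (e i))) * mat_adjoint U"
      using spectral_calculus_unique[OF _ X] by simp
  qed
qed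

lemma mat_log_carrier: "psd d X \<Longrightarrow> mat_log X \<in> carrier_mat d d"
  by (metis psd_spectral_form spectral_form_unitary unitary_matD(1,2) mat_log_spectral_form mult_carrier_mat mat_diag_dim)

section \<open>Traces against spectral functions, and overlaps of eigenbases\<close>

lemma dim_mat_diag [simp]: "dim_row (mat_diag n f) = n" "dim_col (mat_diag n f) = n"
  by (simp_all add: mat_diag_def)

definition diag_entry :: "complex mat \<Rightarrow> complex mat \<Rightarrow> nat \<Rightarrow> complex" where
  "diag_entry V X j = (mat_adjoint V * X * V) $$ (j, j)"

lemma conj_add_smult_mat:
  fixes V :: "complex mat"
  assumes V: "V \<in> carrier_mat d d" and X: "X \<in> carrier_mat d d" and Y: "Y \<in> carrier_mat d d"
  shows "mat_adjoint V * (X + c \<cdot>\<^sub>m Y) * V = mat_adjoint V * X * V + c \<cdot>\<^sub>m (mat_adjoint V * Y * V)"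
proof -
  have "mat_adjoint V * (X + c \<cdot>\<^sub>m Y) = mat_adjoint V * X + c \<cdot>\<^sub>m (mat_adjoint V * Y)"
    using assms by (simp add: mult_add_distrib_mat[of _ d d _ d] mult_smult_distrib[of _ d d _ d])
  also have "\<dots> * V = mat_adjoint V * X * V + c \<cdot>\<^sub>m (mat_adjoint V * Y * V)"
    using assms by (simp add: add_mult_distrib_mat[of _ d d _ _ d] mult_smult_assoc_mat[of _ d d _ d]
        mult_carrier_mat[of _ d d _ d])
  finally show ?thesis .
qed

lemma diag_entry_add_smult:
  assumes "V \<in> carrier_mat d d" "X \<in> carrier_mat d d" "Y \<in> carrier_mat d d" "j < d"
  shows "diag_entry V (X + c \<cdot>\<^sub>m Y) j = diag_entry V X j + c * diag_entry V Y j"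
  using assms by (simp add: diag_entry_def conj_add_smult_mat)

lemma diag_entry_sum:
  assumes "V \<in> carrier_mat d d" "X \<in> carrier_mat d d" "j < d"
  shows "diag_entry V X j = (\<Sum>i<d. \<Sum>l<d. cnj (V $$ (i, j)) * X $$ (i, l) * V $$ (l, j))"
proof -
  have "diag_entry V X j = (\<Sum>l<d. (mat_adjoint V * X) $$ (j, l) * V $$ (l, j))"
    unfolding diag_entry_def using assms by (intro index_mult_mat_sum[of _ d d _ d]) auto
  also have "\<dots> = (\<Sum>l<d. \<Sum>i<d. cnj (V $$ (i, j)) * X $$ (i, l) * V $$ (l, j))"
    using assms by (intro sum.cong refl, subst index_mult_mat_sum[of _ d d _ d])
      (auto simp: sum_distrib_right)
  also have "\<dots> = (\<Sum>i<d. \<Sum>l<d. cnj (V $$ (i, j)) * X $$ (i, l) * V $$ (l, j))"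
    by (rule sum.swap)
  finally show ?thesis .
qed

text \<open>By cyclicity the trace against a matrix that is diagonal in the basis \<open>V\<close>
  sees only the diagonal of \<open>X\<close> in that basis, that is, the expectation values of
  \<open>X\<close> in the columns of \<open>V\<close>.\<close>

lemma mat_trace_mult_conj_diag:
  assumes "unitary_mat d V" "X \<in> carrier_mat d d"
  shows "mat_trace (X * (V * mat_diag d f * mat_adjoint V)) = (\<Sum>j<d. diag_entry V X j * f j)"
proof -
  note v = unitary_matD[OF assms(1)]
  have "X * (V * mat_diag d f * mat_adjoint V) = (X * V * mat_diag d f) * mat_adjoint V"
    using v(1,2) assms(2) by (simp add: square_mat_assoc[where d = d])
  then have "mat_trace (X * (V * mat_diag d f * mat_adjoint V)) =
      mat_trace (mat_adjoint V * (X * V * mat_diag d f))"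
    using v(1,2) assms(2) by (simp add: mat_trace_comm[of _ d d] mult_carrier_mat[of _ d d _ d])
  also have "mat_adjoint V * (X * V * mat_diag d f) = (mat_adjoint V * X * V) * mat_diag d f"
    using v(1,2) assms(2) by (simp add: square_mat_assoc[where d = d])
  also have "mat_trace \<dots> = (\<Sum>j<d. diag_entry V X j * f j)"
    using v(1,2) assms(2)
    by (subst mat_diag_mult_right[of _ d d]) (auto simp: mat_trace_def diag_entry_def mult_carrier_mat[of _ d d _ d])
  finally show ?thesis .
qed

lemma mat_trace_mult_log:
  assumes "spectral_form d Y V f" "X \<in> carrier_mat d d"
  shows "mat_trace (X * mat_log Y) = (\<Sum>j<d. diag_entry V X j * complex_of_real (ln0 (f j)))"
  using mat_trace_mult_conj_diag[OF spectral_form_unitary[OF assms(1)] assms(2)]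
  by (simp add: mat_log_spectral_form[OF assms(1)])

lemma sum_diag_entry:
  assumes "unitary_mat d V" "X \<in> carrier_mat d d"
  shows "(\<Sum>j<d. diag_entry V X j) = mat_trace X"
  using mat_trace_mult_conj_diag[OF assms, of "\<lambda>_. 1"] unitary_matD[OF assms(1)] assms(2)
  by (simp add: right_mult_one_mat[of _ d d])

text \<open>The transition probability |<u_i, v_j>|^2 between the columns of \<open>U\<close> and
  \<open>V\<close>. For unitary matrices its row and column sums are 1.\<close>

definition overlap :: "complex mat \<Rightarrow> complex mat \<Rightarrow> nat \<Rightarrow> nat \<Rightarrow> real" where
  "overlap U V i j = (cmod ((mat_adjoint U * V) $$ (i, j)))\<^sup>2"

lemma overlap_nonneg [simp]: "0 \<le> overlap U V i j"
  by (simp add: overlap_def)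

lemma diag_entry_spectral_form:
  assumes "spectral_form d X U e" "V \<in> carrier_mat d d" "j < d"
  shows "diag_entry V X j = complex_of_real (\<Sum>i<d. overlap U V i j * e i)"
proof -
  note u = unitary_matD[OF spectral_form_unitary[OF assms(1)]]
  have "diag_entry V X j = complex_of_real (\<Sum>k<d. e k * (cmod (\<Sum>i<d. cnj (U $$ (i, k)) * V $$ (i, j)))\<^sup>2)"
    using spectral_form_quadratic[OF assms(1), of "\<lambda>i. V $$ (i, j)"]
    by (simp add: diag_entry_sum[OF assms(2) spectral_form_carrier[OF assms(1)] assms(3)])
  also have "\<dots> = complex_of_real (\<Sum>i<d. overlap U V i j * e i)"
    unfolding overlap_def using u assms(2,3)
    by (auto simp: mult.commute index_mult_mat_sum[of _ d d _ d] simp del: index_mult_mat of_real_sum intro!: sum.cong arg_cong[of _ _ complex_of_real])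
  finally show ?thesis .
qed

lemma diag_entry_eigenbasis:
  assumes "spectral_form d X U e" "j < d"
  shows "diag_entry U X j = complex_of_real (e j)"
proof -
  note u = unitary_matD[OF spectral_form_unitary[OF assms(1)]]
  have "(\<Sum>i<d. overlap U U i j * e i) = (\<Sum>i<d. if i = j then e i else 0)"
    by (rule sum.cong) (use assms(2) u in \<open>auto simp: overlap_def\<close>)
  then show ?thesis
    using assms(2) by (simp add: diag_entry_spectral_form[OF assms(1) u(1) assms(2)] del: of_real_sum)
qed

lemma overlap_sum_left:
  assumes "unitary_mat d U" "unitary_mat d V" "j < d"
  shows "(\<Sum>i<d. overlap U V i j) = 1"
proof -
  let ?W = "mat_adjoint U * V"
  have W: "unitary_mat d ?W" using assms by (intro unitary_mat_mult unitary_mat_adjoint)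
  have "complex_of_real (\<Sum>i<d. overlap U V i j) = (\<Sum>i<d. cnj (?W $$ (i, j)) * ?W $$ (i, j))"
    by (simp add: overlap_def complex_norm_square mult.commute del: index_mult_mat flip: of_real_power)
  also have "\<dots> = 1" using unitary_col_orthonormal[OF W assms(3,3)] by simp
  finally show ?thesis by (simp only: of_real_eq_1_iff)
qed

lemma overlap_commute:
  assumes "U \<in> carrier_mat d d" "V \<in> carrier_mat d d" "i < d" "j < d"
  shows "overlap U V i j = overlap V U j i"
proof -
  have "mat_adjoint (mat_adjoint U * V) = mat_adjoint V * U"
    using assms by (simp add: mat_adjoint_mult[of _ d d _ d])
  then have "(mat_adjoint V * U) $$ (j, i) = mat_adjoint (mat_adjoint U * V) $$ (j, i)" by simp
  also have "\<dots> = cnj ((mat_adjoint U * V) $$ (i, j))"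
    using assms by (intro mat_adjoint_index) auto
  finally show ?thesis by (simp add: overlap_def del: index_mult_mat)
qed

lemma overlap_sum_right:
  assumes "unitary_mat d U" "unitary_mat d V" "i < d"
  shows "(\<Sum>j<d. overlap U V i j) = 1"
  using overlap_sum_left[OF assms(2,1,3)] overlap_commute[of U d V i] unitary_matD(1)[OF assms(1)]
    unitary_matD(1)[OF assms(2)] assms(3) by simp

text \<open>An eigenvector of \<sigma> for eigenvalue 0 is in the kernel of \<rho>, so the
  expectation of \<rho> in it is 0; that expectation is a sum of the nonnegative numbers
  \<open>overlap U V i j * e i\<close>. These vanishing weights make the conventions
  \<open>ln0 0 = 0\<close> and division by 0 harmless.\<close>

lemma overlap_kernel:
  assumes r: "psd d \<rho>" and rf: "spectral_form d \<rho> U e" and sf: "spectral_form d \<sigma> V f"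
    and ker: "mat_kernel \<sigma> \<subseteq> mat_kernel \<rho>" and ij: "i < d" "j < d" and fj: "f j = 0"
  shows "overlap U V i j * e i = 0" "diag_entry V \<rho> j = 0"
proof -
  note v = unitary_matD[OF spectral_form_unitary[OF sf]]
  have "col V j \<in> mat_kernel \<sigma>"
    using spectral_form_mult_col[OF sf ij(2)] fj v spectral_form_carrier[OF sf] by (auto simp: mat_kernel_def)
  then have "(\<Sum>l<d. \<rho> $$ (k, l) * V $$ (l, j)) = 0" if "k < d" for k
    using ker that v ij by (auto simp: mat_kernel_iff[OF psd_carrier[OF r]])
  then show d0: "diag_entry V \<rho> j = 0"
    unfolding diag_entry_sum[OF v(1) psd_carrier[OF r] ij(2)]
    by (auto simp: mult.assoc simp flip: sum_distrib_left)
  then have "(\<Sum>i<d. overlap U V i j * e i) = 0"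
    unfolding diag_entry_spectral_form[OF rf v(1) ij(2)] by (simp only: of_real_eq_0_iff)
  then show "overlap U V i j * e i = 0"
    using psd_spectral_form_nonneg[OF r rf] ij by (subst (asm) sum_nonneg_eq_0_iff) auto
qed

text \<open>The finite branch of \<open>rel_entropy\<close> as a real number, available for
  subtraction and limits. It agrees with the relative entropy once the kernel of \<sigma> is
  contained in that of \<rho>.\<close>

definition rel_ent :: "complex mat \<Rightarrow> complex mat \<Rightarrow> real" where
  "rel_ent \<rho> \<sigma> = Re (mat_trace (\<rho> * (mat_log \<rho> - mat_log \<sigma>)))"

lemma rel_ent_diff:
  assumes "psd d \<rho>" "psd d \<sigma>"
  shows "rel_ent \<rho> \<sigma> = Re (mat_trace (\<rho> * mat_log \<rho>)) - Re (mat_trace (\<rho> * mat_log \<sigma>))"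
  using psd_carrier[OF assms(1)] mat_log_carrier[OF assms(1)] mat_log_carrier[OF assms(2)]
  by (simp add: rel_ent_def mult_minus_distrib_mat[of _ d d _ d] mat_trace_minus[of _ d] mult_carrier_mat[of _ d d _ d])

text \<open>Expand both traces in eigenbases and insert row sums 1. The weights
  \<open>overlap U V i j * e i\<close> and \<open>overlap U V i j * f j\<close> are the
  Nussbaum-Szkola pair: the expression becomes a classical one, to which scalar inequalities apply
  although \<rho> and \<sigma> need not commute.\<close>

lemma rel_ent_overlap:
  assumes rf: "spectral_form d \<rho> U e" and sf: "spectral_form d \<sigma> V f" and r: "psd d \<rho>" and s: "psd d \<sigma>"
  shows "rel_ent \<rho> \<sigma> = (\<Sum>i<d. \<Sum>j<d. overlap U V i j * (e i * (ln0 (e i) - ln0 (f j))))"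
proof -
  note u = unitary_matD[OF spectral_form_unitary[OF rf]]
  note v = unitary_matD[OF spectral_form_unitary[OF sf]]
  have "diag_entry U \<rho> j = complex_of_real (e j)" if "j < d" for j
    by (rule diag_entry_eigenbasis[OF rf that])
  then have "Re (mat_trace (\<rho> * mat_log \<rho>)) = (\<Sum>i<d. e i * ln0 (e i))"
    by (simp add: mat_trace_mult_log[OF rf psd_carrier[OF r]])
  also have "\<dots> = (\<Sum>i<d. e i * ln0 (e i) * (\<Sum>j<d. overlap U V i j))"
    using overlap_sum_right[OF spectral_form_unitary[OF rf] spectral_form_unitary[OF sf]] by simp
  finally have 1: "Re (mat_trace (\<rho> * mat_log \<rho>)) = (\<Sum>i<d. \<Sum>j<d. overlap U V i j * (e i * ln0 (e i)))"
    by (simp add: sum_distrib_left mult_ac)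
  have "Re (mat_trace (\<rho> * mat_log \<sigma>)) = (\<Sum>j<d. (\<Sum>i<d. overlap U V i j * e i) * ln0 (f j))"
    by (simp add: mat_trace_mult_log[OF sf psd_carrier[OF r]] diag_entry_spectral_form[OF rf v(1)] del: of_real_sum)
  also have "\<dots> = (\<Sum>j<d. \<Sum>i<d. overlap U V i j * (e i * ln0 (f j)))"
    by (simp add: sum_distrib_left sum_distrib_right mult_ac)
  also have "\<dots> = (\<Sum>i<d. \<Sum>j<d. overlap U V i j * (e i * ln0 (f j)))" by (rule sum.swap)
  finally show ?thesis unfolding rel_ent_diff[OF r s] 1
    by (simp add: algebra_simps sum_subtractf)
qed

section \<open>Klein's inequality and the chi-square bound\<close>

lemma mat_trace_spectral_form:
  assumes "spectral_form d X U e"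
  shows "mat_trace X = complex_of_real (\<Sum>i<d. e i)"
proof -
  note u = unitary_matD[OF spectral_form_unitary[OF assms]]
  have "mat_trace X = (\<Sum>j<d. diag_entry U X j)"
    using sum_diag_entry[OF spectral_form_unitary[OF assms] spectral_form_carrier[OF assms]] by simp
  also have "\<dots> = (\<Sum>j<d. complex_of_real (e j))"
    by (simp add: diag_entry_eigenbasis[OF assms])
  finally show ?thesis by simp
qed

text \<open>The bound ln x \<le> x - 1 at x = f_j / e_i gives e_i (ln e_i - ln f_j) \<ge> e_i - f_j.
  Weighted by the overlaps, the right sides sum to the difference of the traces, which is 0. If
  \<open>e i = 0\<close> the inequality reads 0 \<ge> - f_j, and if only \<open>f j = 0\<close> the
  overlap vanishes.\<close>

lemma rel_ent_nonneg:
  assumes r: "state d \<rho>" and s: "state d \<sigma>" and ker: "mat_kernel \<sigma> \<subseteq> mat_kernel \<rho>"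
  shows "0 \<le> rel_ent \<rho> \<sigma>"
proof -
  have rp: "psd d \<rho>" and sp: "psd d \<sigma>" using r s by (auto simp: state_def)
  obtain U e where rf: "spectral_form d \<rho> U e" and e: "\<And>i. i < d \<Longrightarrow> 0 \<le> e i"
    using psd_spectral_form[OF rp] by blast
  obtain V f where sf: "spectral_form d \<sigma> V f" and f: "\<And>i. i < d \<Longrightarrow> 0 \<le> f i"
    using psd_spectral_form[OF sp] by blast
  note uv = spectral_form_unitary[OF rf] spectral_form_unitary[OF sf]
  let ?P = "overlap U V"
  have "complex_of_real (\<Sum>i<d. e i) = 1" "complex_of_real (\<Sum>i<d. f i) = 1"
    using mat_trace_spectral_form[OF rf] mat_trace_spectral_form[OF sf] r s by (auto simp: state_def)
  then have tr: "(\<Sum>i<d. e i) = 1" "(\<Sum>i<d. f i) = 1" by (simp_all only: of_real_eq_1_iff)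
  have "(\<Sum>i<d. \<Sum>j<d. ?P i j * (e i - f j)) =
      (\<Sum>i<d. e i * (\<Sum>j<d. ?P i j)) - (\<Sum>j<d. f j * (\<Sum>i<d. ?P i j))"
    using sum.swap[of "\<lambda>i j. f j * ?P i j" "{..<d}" "{..<d}"]
    by (simp add: algebra_simps sum_subtractf sum_distrib_left)
  also have "\<dots> = 0"
    using tr overlap_sum_right[OF uv] overlap_sum_left[OF uv] by simp
  finally have "0 = (\<Sum>i<d. \<Sum>j<d. ?P i j * (e i - f j))" by simp
  also have "\<dots> \<le> (\<Sum>i<d. \<Sum>j<d. ?P i j * (e i * (ln0 (e i) - ln0 (f j))))"
  proof (intro sum_mono)
    fix i j assume "i \<in> {..<d}" "j \<in> {..<d}"
    then have ij: "i < d" "j < d" by auto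
    consider "e i = 0" | "e i > 0" "f j = 0" | "e i > 0" "f j > 0" using e[OF ij(1)] f[OF ij(2)] by linarith
    then show "?P i j * (e i - f j) \<le> ?P i j * (e i * (ln0 (e i) - ln0 (f j)))"
    proof cases
      case 1
      then show ?thesis using f[OF ij(2)] by (auto intro!: mult_left_mono)
    next
      case 2
      then have "?P i j = 0" using overlap_kernel(1)[OF rp rf sf ker ij] by simp
      then show ?thesis by simp
    next
      case 3
      have "ln (f j / e i) \<le> f j / e i - 1" using 3 by (intro ln_le_minus_one) auto
      then have "e i * (1 - f j / e i) \<le> e i * (ln (e i) - ln (f j))"
        using 3 by (intro mult_left_mono) (auto simp: ln_div)
      also have "e i * (1 - f j / e i) = e i - f j" using 3 by (simp add: field_simps)
      finally show ?thesis using 3 by (intro mult_left_mono) (auto simp: ln0_pos)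
    qed
  qed
  finally show ?thesis by (simp add: rel_ent_overlap[OF rf sf rp sp])
qed

text \<open>The \<open>\<chi>\<^sup>2\<close> upper bound \<open>D(\<omega>\<parallel>\<sigma>) \<le> Tr \<omega>\<^sup>2 \<sigma>\<^sup>-\<^sup>1 - 1\<close>; the factor \<open>1 / f j\<close> is \<open>0\<close>
  on the kernel of \<open>\<sigma>\<close>.\<close>

lemma rel_ent_le_chi_square:
  assumes r: "state d \<rho>" and s: "state d \<sigma>" and ker: "mat_kernel \<sigma> \<subseteq> mat_kernel \<rho>"
    and sf: "spectral_form d \<sigma> V f"
  shows "rel_ent \<rho> \<sigma> \<le> Re (\<Sum>j<d. diag_entry V (\<rho> * \<rho>) j / complex_of_real (f j)) - 1"
proof -
  have rp: "psd d \<rho>" and sp: "psd d \<sigma>" using r s by (auto simp: state_def)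
  obtain U e where rf: "spectral_form d \<rho> U e" and e: "\<And>i. i < d \<Longrightarrow> 0 \<le> e i"
    using psd_spectral_form[OF rp] by blast
  note f = psd_spectral_form_nonneg[OF sp sf]
  note uv = spectral_form_unitary[OF rf] spectral_form_unitary[OF sf]
  note u = unitary_matD[OF uv(1)] and v = unitary_matD[OF uv(2)]
  let ?P = "overlap U V"
  have "complex_of_real (\<Sum>i<d. e i) = 1"
    using mat_trace_spectral_form[OF rf] r by (auto simp: state_def)
  then have tr: "(\<Sum>i<d. e i) = 1" by (simp only: of_real_eq_1_iff)
  let ?D = "mat_diag d (\<lambda>i. complex_of_real (e i))"
  have "\<rho> * \<rho> = U * ?D * (mat_adjoint U * U) * ?D * mat_adjoint U"
    using rf u(1,2) by (simp add: spectral_form_def square_mat_assoc[where d = d])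
  also have "\<dots> = U * (?D * ?D) * mat_adjoint U"
    unfolding u(3) using u(1,2) mat_diag_dim[of d "\<lambda>i. complex_of_real (e i)"]
    by (simp add: square_mat_assoc[where d = d] left_mult_one_mat[of _ d d] del: mat_diag_diag)
  finally have r2: "spectral_form d (\<rho> * \<rho>) U (\<lambda>i. e i * e i)"
    using uv by (simp add: spectral_form_def)
  have "rel_ent \<rho> \<sigma> = (\<Sum>i<d. \<Sum>j<d. ?P i j * (e i * (ln0 (e i) - ln0 (f j))))"
    by (rule rel_ent_overlap[OF rf sf rp sp])
  also have "\<dots> \<le> (\<Sum>i<d. \<Sum>j<d. ?P i j * (e i * e i / f j - e i))"
  proof (intro sum_mono)
    fix i j assume "i \<in> {..<d}" "j \<in> {..<d}"
    then have ij: "i < d" "j < d" by auto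
    consider "e i = 0" | "e i > 0" "f j = 0" | "e i > 0" "f j > 0" using e[OF ij(1)] f[OF ij(2)] by linarith
    then show "?P i j * (e i * (ln0 (e i) - ln0 (f j))) \<le> ?P i j * (e i * e i / f j - e i)"
    proof cases
      case 2
      then have "?P i j = 0" using overlap_kernel(1)[OF rp rf sf ker ij] by simp
      then show ?thesis by simp
    next
      case 3
      \<comment> \<open>The same scalar inequality at the inverse ratio: it now bounds the entropy
        from above and produces the squared eigenvalue over \<open>f j\<close>.\<close>
      have "ln (e i / f j) \<le> e i / f j - 1" using 3 by (intro ln_le_minus_one) auto
      then have "e i * (ln (e i) - ln (f j)) \<le> e i * (e i / f j - 1)"
        using 3 by (intro mult_left_mono) (auto simp: ln_div)
      then show ?thesis using 3 by (intro mult_left_mono) (auto simp: ln0_pos field_simps)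
    qed simp
  qed
  also have "\<dots> = (\<Sum>i<d. \<Sum>j<d. ?P i j * (e i * e i) / f j) - (\<Sum>i<d. e i * (\<Sum>j<d. ?P i j))"
    by (simp add: algebra_simps sum_subtractf sum_distrib_left)
  also have "(\<Sum>i<d. e i * (\<Sum>j<d. ?P i j)) = 1" using tr overlap_sum_right[OF uv] by simp
  also have "(\<Sum>i<d. \<Sum>j<d. ?P i j * (e i * e i) / f j) = (\<Sum>j<d. \<Sum>i<d. ?P i j * (e i * e i) / f j)"
    by (rule sum.swap)
  also have "\<dots> = Re (\<Sum>j<d. diag_entry V (\<rho> * \<rho>) j / complex_of_real (f j))"
    by (simp add: diag_entry_spectral_form[OF r2 v(1)] sum_divide_distrib del: of_real_sum flip: of_real_divide)
  finally show ?thesis .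
qed

section \<open>Mixtures and the quadratic bound near the second state\<close>

definition mix :: "real \<Rightarrow> complex mat \<Rightarrow> complex mat \<Rightarrow> complex mat" where
  "mix t \<rho> \<sigma> = complex_of_real t \<cdot>\<^sub>m \<rho> + complex_of_real (1 - t) \<cdot>\<^sub>m \<sigma>"

lemma psd_add:
  assumes X: "psd d X" and Y: "psd d Y"
  shows "psd d (X + Y)"
  unfolding psd_iff
proof (intro conjI allI impI)
  note c = psd_carrier[OF X] psd_carrier[OF Y]
  show "X + Y \<in> carrier_mat d d" using c by simp
  fix i j assume ij: "i < d" "j < d"
  then show "(X + Y) $$ (j, i) = cnj ((X + Y) $$ (i, j))"
    using c psd_hermitian[OF X ij, symmetric] psd_hermitian[OF Y ij, symmetric] by simp
next
  fix f
  have "(\<Sum>i<d. \<Sum>j<d. cnj (f i) * (X + Y) $$ (i, j) * f j) =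
    (\<Sum>i<d. \<Sum>j<d. cnj (f i) * X $$ (i, j) * f j) + (\<Sum>i<d. \<Sum>j<d. cnj (f i) * Y $$ (i, j) * f j)"
    using psd_carrier[OF X] psd_carrier[OF Y] by (simp add: algebra_simps sum.distrib)
  then show "0 \<le> Re (\<Sum>i<d. \<Sum>j<d. cnj (f i) * (X + Y) $$ (i, j) * f j)"
    using psd_quadratic_nonneg[OF X, of f] psd_quadratic_nonneg[OF Y, of f] by (simp only: plus_complex.sel)
qed

lemma spectral_form_smult:
  assumes s: "spectral_form d X U e"
  shows "spectral_form d (complex_of_real c \<cdot>\<^sub>m X) U (\<lambda>i. c * e i)"
proof -
  note u = unitary_matD[OF spectral_form_unitary[OF s]]
  have "complex_of_real c \<cdot>\<^sub>m X = U * (complex_of_real c \<cdot>\<^sub>m mat_diag d (\<lambda>i. complex_of_real (e i))) * mat_adjoint U"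
    using s u by (simp add: spectral_form_def mult_smult_distrib[of _ d d _ d]
        mult_smult_assoc_mat[of _ d d _ d] mult_carrier_mat[of _ d d _ d])
  also have "complex_of_real c \<cdot>\<^sub>m mat_diag d (\<lambda>i. complex_of_real (e i)) = mat_diag d (\<lambda>i. complex_of_real (c * e i))"
    by (rule eq_matI) (auto simp: mat_diag_def)
  finally show ?thesis using s by (simp add: spectral_form_def)
qed

lemma psd_smult:
  assumes "psd d X" "0 \<le> c"
  shows "psd d (complex_of_real c \<cdot>\<^sub>m X)"
proof -
  obtain U e where s: "spectral_form d X U e" and e: "\<And>i. i < d \<Longrightarrow> 0 \<le> e i"
    using psd_spectral_form[OF assms(1)] by blast
  show ?thesis by (rule psd_spectral_formI[OF spectral_form_smult[OF s]]) (use assms(2) e in auto)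
qed

lemma state_mix:
  assumes "state d \<rho>" "state d \<sigma>" "0 \<le> t" "t \<le> 1"
  shows "state d (mix t \<rho> \<sigma>)"
  using assms psd_add[OF psd_smult[of d \<rho> t] psd_smult[of d \<sigma> "1 - t"]] psd_carrier[of d \<rho>] psd_carrier[of d \<sigma>]
  by (auto simp: state_def mix_def mat_trace_add[of _ d] mat_trace_smult[of _ d])

lemma mat_kernel_mix:
  assumes "\<rho> \<in> carrier_mat d d" "\<sigma> \<in> carrier_mat d d" "mat_kernel \<sigma> \<subseteq> mat_kernel \<rho>"
  shows "mat_kernel \<sigma> \<subseteq> mat_kernel (mix t \<rho> \<sigma>)"
proof
  have M: "mix t \<rho> \<sigma> \<in> carrier_mat d d" using assms by (simp add: mix_def)
  fix v assume v: "v \<in> mat_kernel \<sigma>"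
  then have v': "v \<in> mat_kernel \<rho>" using assms by blast
  have "(\<Sum>j<d. mix t \<rho> \<sigma> $$ (i, j) * v $ j) = 0" if i: "i < d" for i
  proof -
    have "(\<Sum>j<d. mix t \<rho> \<sigma> $$ (i, j) * v $ j) =
      complex_of_real t * (\<Sum>j<d. \<rho> $$ (i, j) * v $ j) + complex_of_real (1 - t) * (\<Sum>j<d. \<sigma> $$ (i, j) * v $ j)"
      using assms(1,2) i by (simp add: mix_def algebra_simps sum.distrib sum_distrib_left sum_subtractf)
    then show ?thesis using v v' i unfolding mat_kernel_iff[OF assms(1)] mat_kernel_iff[OF assms(2)] by simp
  qed
  then show "v \<in> mat_kernel (mix t \<rho> \<sigma>)"
    using v unfolding mat_kernel_iff[OF M] mat_kernel_iff[OF assms(2)] by simp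
qed

text \<open>In an eigenbasis of \<sigma> the mixture is the diagonal matrix of \<open>f\<close> plus
  \<open>t\<close> times \<open>B\<close>, the conjugate of \<rho> - \<sigma>. In the chi-square
  bound the constant part sums to the trace of \<sigma>, cancelling the 1, and the linear part to
  twice the trace of \<open>B\<close>, which is 0.\<close>

lemma rel_ent_mix_quadratic:
  assumes r: "state d \<rho>" and s: "state d \<sigma>" and ker: "mat_kernel \<sigma> \<subseteq> mat_kernel \<rho>"
  obtains C where "\<And>t. 0 \<le> t \<Longrightarrow> t \<le> 1 \<Longrightarrow> rel_ent (mix t \<rho> \<sigma>) \<sigma> \<le> C * t\<^sup>2"
proof -
  have rp: "psd d \<rho>" and sp: "psd d \<sigma>" using r s by (auto simp: state_def)
  have R: "\<rho> \<in> carrier_mat d d" and S: "\<sigma> \<in> carrier_mat d d" using rp sp by (auto simp: psd_def)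
  obtain V f where sf: "spectral_form d \<sigma> V f" and f: "\<And>i. i < d \<Longrightarrow> 0 \<le> f i"
    using psd_spectral_form[OF sp] by blast
  obtain U e where rf: "spectral_form d \<rho> U e" and e: "\<And>i. i < d \<Longrightarrow> 0 \<le> e i"
    using psd_spectral_form[OF rp] by blast
  note v = unitary_matD[OF spectral_form_unitary[OF sf]]
  have M: "mix t \<rho> \<sigma> \<in> carrier_mat d d" for t using R S by (simp add: mix_def)
  define B where "B = mat_adjoint V * (\<rho> - \<sigma>) * V"
  let ?D = "mat_diag d (\<lambda>i. complex_of_real (f i))"
  have B: "B \<in> carrier_mat d d" using R S v by (auto simp: B_def)
  have VM: "mat_adjoint V * mix t \<rho> \<sigma> * V = ?D + complex_of_real t \<cdot>\<^sub>m B" for t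
  proof -
    have "mix t \<rho> \<sigma> = \<sigma> + complex_of_real t \<cdot>\<^sub>m (\<rho> - \<sigma>)"
      by (rule eq_matI) (use R S in \<open>auto simp: mix_def algebra_simps\<close>)
    moreover have "mat_adjoint V * \<sigma> * V = (mat_adjoint V * V) * ?D * (mat_adjoint V * V)"
      using sf v(1,2) by (simp add: spectral_form_def square_mat_assoc[where d = d])
    then have "mat_adjoint V * \<sigma> * V = ?D"
      using v by (simp add: left_mult_one_mat[of _ d d] right_mult_one_mat[of _ d d])
    ultimately show ?thesis
      unfolding B_def using conj_add_smult_mat[OF v(1) S minus_carrier_mat[OF S]] by simp
  qed
  have sq: "diag_entry V (mix t \<rho> \<sigma> * mix t \<rho> \<sigma>) j =
      complex_of_real (f j * f j) + 2 * complex_of_real (t * f j) * B $$ (j, j) +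
      complex_of_real (t\<^sup>2) * (B * B) $$ (j, j)" if j: "j < d" for t j
  proof -
    let ?M = "mix t \<rho> \<sigma>"
    have "mat_adjoint V * (?M * ?M) * V = mat_adjoint V * ?M * (V * mat_adjoint V) * ?M * V"
      unfolding v(4) using v(1,2) M[of t] by (simp add: square_mat_assoc[where d = d])
    also have "\<dots> = (mat_adjoint V * ?M * V) * (mat_adjoint V * ?M * V)"
      using v(1,2) M[of t] by (simp add: square_mat_assoc[where d = d])
    also have "\<dots> = ?D * ?D + complex_of_real t \<cdot>\<^sub>m (?D * B) + complex_of_real t \<cdot>\<^sub>m (B * ?D)
       + complex_of_real (t\<^sup>2) \<cdot>\<^sub>m (B * B)"
      unfolding VM using B
      by (simp add: mult_add_distrib_mat[of _ d d _ d] add_mult_distrib_mat[of _ d d _ _ d]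
          mult_smult_distrib[of _ d d _ d] mult_smult_assoc_mat[of _ d d _ d]
          mult_carrier_mat[of _ d d _ d] del: mat_diag_diag)
        (rule eq_matI, auto simp: power2_eq_square algebra_simps simp del: index_mult_mat(1) mat_diag_diag)
    finally have M2: "mat_adjoint V * (?M * ?M) * V = \<dots>" .
    have D: "mat_diag d g $$ (j, j) = g j" for g :: "nat \<Rightarrow> complex"
      using j by (simp add: mat_diag_def)
    show ?thesis
      unfolding diag_entry_def M2
      using j B by (simp add: mat_diag_mult_left[OF B] mat_diag_mult_right[OF B] D del: index_mult_mat(1))
  qed
  \<comment> \<open>Where \<open>f j = 0\<close> the quotient by \<open>f j\<close> is 0 by
    convention and would drop the linear term; since that diagonal entry is 0, the linear terms
    still add up to the full trace of \<open>B\<close>.\<close>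
  have Bz: "B $$ (j, j) = 0" if j: "j < d" and fj: "f j = 0" for j
  proof -
    have "\<rho> - \<sigma> = \<rho> + (-1) \<cdot>\<^sub>m \<sigma>" by (rule eq_matI) (use R S in auto)
    then have "B $$ (j, j) = diag_entry V \<rho> j - diag_entry V \<sigma> j"
      using R S v j diag_entry_add_smult[of V d \<rho> \<sigma> j "-1"]
      by (simp add: B_def diag_entry_def)
    then show ?thesis
      using overlap_kernel(2)[OF rp rf sf ker j j fj] overlap_kernel(2)[OF sp sf sf subset_refl j j fj] by simp
  qed
  have trB: "(\<Sum>j<d. B $$ (j, j)) = 0"
  proof -
    have "(\<Sum>j<d. B $$ (j, j)) = mat_trace (\<rho> - \<sigma>)"
      using sum_diag_entry[OF spectral_form_unitary[OF sf] minus_carrier_mat[OF S], of \<rho>]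
      by (simp add: B_def diag_entry_def del: index_mult_mat(1))
    then show ?thesis using r s R S by (simp add: mat_trace_minus[of _ d] state_def)
  qed
  have "complex_of_real (\<Sum>i<d. f i) = 1"
    using mat_trace_spectral_form[OF sf] s by (auto simp: state_def)
  then have tr: "(\<Sum>i<d. complex_of_real (f i)) = 1" by simp
  \<comment> \<open>The chi-square divergence Tr (\<rho> - \<sigma>)^2 \<sigma>^(-1), with the
    inverse taken on the support of \<sigma>.\<close>
  define C where "C = Re (\<Sum>j<d. (B * B) $$ (j, j) / complex_of_real (f j))"
  have "rel_ent (mix t \<rho> \<sigma>) \<sigma> \<le> C * t\<^sup>2" if t: "0 \<le> t" "t \<le> 1" for t
  proof -
    have "diag_entry V (mix t \<rho> \<sigma> * mix t \<rho> \<sigma>) j / complex_of_real (f j) =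
       complex_of_real (f j) + 2 * complex_of_real t * B $$ (j, j) +
       complex_of_real (t\<^sup>2) * ((B * B) $$ (j, j) / complex_of_real (f j))" if j: "j < d" for j
      using sq[OF j, of t] Bz[OF j] by (cases "f j = 0") (auto simp: field_simps simp del: index_mult_mat(1))
    then have "(\<Sum>j<d. diag_entry V (mix t \<rho> \<sigma> * mix t \<rho> \<sigma>) j / complex_of_real (f j)) =
       (\<Sum>j<d. complex_of_real (f j)) + 2 * complex_of_real t * (\<Sum>j<d. B $$ (j, j)) +
       complex_of_real (t\<^sup>2) * (\<Sum>j<d. (B * B) $$ (j, j) / complex_of_real (f j))"
      by (simp add: sum.distrib sum_distrib_left del: index_mult_mat(1))
    then have "Re (\<Sum>j<d. diag_entry V (mix t \<rho> \<sigma> * mix t \<rho> \<sigma>) j / complex_of_real (f j)) = 1 + t\<^sup>2 * C"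
      unfolding tr trB C_def by (simp del: index_mult_mat(1) Re_sum flip: of_real_power)
    then show ?thesis
      using rel_ent_le_chi_square[OF state_mix[OF r s t] s mat_kernel_mix[OF R S ker] sf]
      by (simp add: mult.commute)
  qed
  then show thesis by (rule that)
qed

section \<open>Block-diagonal matrices\<close>

lemma pair_index:
  fixes u k n d :: nat
  assumes "k < d"
  shows "(u * d + k) div d = u" "(u * d + k) mod d = k" "u < n \<Longrightarrow> u * d + k < n * d"
proof -
  show "(u * d + k) div d = u" "(u * d + k) mod d = k" using assms by auto
  assume "u < n"
  then have "Suc u * d \<le> n * d" by (intro mult_right_mono) auto
  then show "u * d + k < n * d" using assms by simp
qed

lemma pair_index_eq_iff:
  fixes u v k l d :: nat
  assumes "k < d" "l < d"
  shows "u * d + k = v * d + l \<longleftrightarrow> u = v \<and> k = l"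
  using assms by (metis pair_index(1,2))

lemma pair_index_cases:
  fixes i n d :: nat
  assumes "i < n * d"
  obtains u k where "u < n" "k < d" "i = u * d + k"
proof
  show "i div d < n" using assms by (simp add: less_mult_imp_div_less)
  show "i mod d < d" using assms by (cases d) auto
qed simp

lemma sum_pair_index:
  fixes n d :: nat
  shows "(\<Sum>i<n * d. h i) = (\<Sum>u<n. \<Sum>k<d. h (u * d + k))"
proof -
  have "(\<Sum>i<n * d. h i) = (\<Sum>u<n. sum h {u * d..<u * d + d})" by (rule sum.nat_group[symmetric])
  also have "\<dots> = (\<Sum>u<n. \<Sum>k<d. h (u * d + k))"
  proof (rule sum.cong)
    fix u
    show "sum h {u * d..<u * d + d} = (\<Sum>k<d. h (u * d + k))"
      using sum.shift_bounds_nat_ivl[of h 0 "u * d" d] by (simp add: add.commute lessThan_atLeast0)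
  qed simp
  finally show ?thesis .
qed

text \<open>The operator \<Sum>u. |u><u| \<otimes> M u. Classical-quantum states and the products of
  their marginals have this shape, on which products, adjoints, spectra and logarithms are computed
  block by block.\<close>

definition bdiag :: "nat \<Rightarrow> nat \<Rightarrow> (nat \<Rightarrow> complex mat) \<Rightarrow> complex mat" where
  "bdiag n d M = mat (n * d) (n * d)
     (\<lambda>(i, j). if i div d = j div d then M (i div d) $$ (i mod d, j mod d) else 0)"

lemma bdiag_carrier [simp]: "bdiag n d M \<in> carrier_mat (n * d) (n * d)"
  and dim_bdiag [simp]: "dim_row (bdiag n d M) = n * d" "dim_col (bdiag n d M) = n * d"
  by (simp_all add: bdiag_def)

lemma bdiag_index:
  assumes "u < n" "v < n" "k < d" "l < d"
  shows "bdiag n d M $$ (u * d + k, v * d + l) = (if u = v then M u $$ (k, l) else 0)"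
  using assms pair_index(1,2)[of k d u] pair_index(1,2)[of l d v] pair_index(3)[of k d u n]
    pair_index(3)[of l d v n] by (simp add: bdiag_def)

lemma bdiag_cong: "(\<And>u. u < n \<Longrightarrow> M u = M' u) \<Longrightarrow> bdiag n d M = bdiag n d M'"
  unfolding bdiag_def by (rule cong_mat) (auto simp: less_mult_imp_div_less)

lemma bdiag_eqI:
  assumes "A \<in> carrier_mat (n * d) (n * d)"
    and "\<And>u v k l. u < n \<Longrightarrow> v < n \<Longrightarrow> k < d \<Longrightarrow> l < d \<Longrightarrow>
      A $$ (u * d + k, v * d + l) = (if u = v then M u $$ (k, l) else 0)"
  shows "A = bdiag n d M"
proof (rule eq_matI)
  fix i j assume "i < dim_row (bdiag n d M)" "j < dim_col (bdiag n d M)"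
  then have "i < n * d" "j < n * d" by auto
  then obtain u k v l where "u < n" "k < d" "i = u * d + k" "v < n" "l < d" "j = v * d + l"
    by (metis pair_index_cases)
  then show "A $$ (i, j) = bdiag n d M $$ (i, j)" by (simp add: assms(2) bdiag_index)
qed (use assms in auto)

lemma bdiag_mult:
  assumes "\<And>u. u < n \<Longrightarrow> A u \<in> carrier_mat d d" "\<And>u. u < n \<Longrightarrow> B u \<in> carrier_mat d d"
  shows "bdiag n d A * bdiag n d B = bdiag n d (\<lambda>u. A u * B u)"
proof (rule bdiag_eqI)
  fix u v k l assume uv: "u < n" "v < n" "k < d" "l < d"
  have "(bdiag n d A * bdiag n d B) $$ (u * d + k, v * d + l) =
     (\<Sum>w<n. \<Sum>m<d. bdiag n d A $$ (u * d + k, w * d + m) * bdiag n d B $$ (w * d + m, v * d + l))"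
    using uv by (subst index_mult_mat_sum[of _ "n * d" "n * d" _ "n * d"]) (auto simp: pair_index sum_pair_index)
  also have "\<dots> = (\<Sum>w<n. if u = w then \<Sum>m<d. A u $$ (k, m) * bdiag n d B $$ (u * d + m, v * d + l) else 0)"
    using uv by (intro sum.cong) (auto simp: bdiag_index)
  also have "\<dots> = (\<Sum>m<d. A u $$ (k, m) * bdiag n d B $$ (u * d + m, v * d + l))"
    using uv by simp
  also have "\<dots> = (if u = v then (A u * B u) $$ (k, l) else 0)"
    using uv assms by (auto simp: bdiag_index index_mult_mat_sum[of _ d d _ d] simp del: index_mult_mat(1))
  finally show "(bdiag n d A * bdiag n d B) $$ (u * d + k, v * d + l) = (if u = v then (A u * B u) $$ (k, l) else 0)" .
qed auto

lemma mat_adjoint_bdiag: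
  assumes "\<And>u. u < n \<Longrightarrow> A u \<in> carrier_mat d d"
  shows "mat_adjoint (bdiag n d A) = bdiag n d (\<lambda>u. mat_adjoint (A u))"
proof (rule bdiag_eqI)
  fix u v k l assume uv: "u < n" "v < n" "k < d" "l < d"
  then show "mat_adjoint (bdiag n d A) $$ (u * d + k, v * d + l) = (if u = v then mat_adjoint (A u) $$ (k, l) else 0)"
    using assms[OF uv(1)] by (auto simp: pair_index bdiag_index)
qed auto

lemma mat_diag_bdiag: "mat_diag (n * d) (\<lambda>i. f (i div d) (i mod d)) = bdiag n d (\<lambda>u. mat_diag d (f u))"
proof (rule bdiag_eqI)
  fix u v k l assume uv: "u < n" "v < n" "k < d" "l < d"
  show "mat_diag (n * d) (\<lambda>i. f (i div d) (i mod d)) $$ (u * d + k, v * d + l) =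
      (if u = v then mat_diag d (f u) $$ (k, l) else 0)"
    using uv by (auto simp: mat_diag_def pair_index pair_index_eq_iff)
qed auto

lemma one_mat_bdiag: "1\<^sub>m (n * d) = bdiag n d (\<lambda>u. 1\<^sub>m d)"
  using mat_diag_bdiag[of n d "\<lambda>_ _. 1"] by simp

lemma unitary_bdiag:
  assumes "\<And>u. u < n \<Longrightarrow> unitary_mat d (U u)"
  shows "unitary_mat (n * d) (bdiag n d U)"
proof -
  note U = unitary_matD[OF assms]
  have "mat_adjoint (bdiag n d U) * bdiag n d U = bdiag n d (\<lambda>u. mat_adjoint (U u) * U u)"
    using U by (simp add: mat_adjoint_bdiag bdiag_mult)
  also have "\<dots> = 1\<^sub>m (n * d)" unfolding one_mat_bdiag using U by (intro bdiag_cong) auto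
  finally show ?thesis by (simp add: unitary_mat_def)
qed

lemma bdiag_conj_diag:
  assumes "\<And>u. u < n \<Longrightarrow> unitary_mat d (U u)"
  shows "bdiag n d U * mat_diag (n * d) (\<lambda>i. f (i div d) (i mod d)) * mat_adjoint (bdiag n d U) =
    bdiag n d (\<lambda>u. U u * mat_diag d (f u) * mat_adjoint (U u))"
  using unitary_matD(1,2)[OF assms]
  by (simp add: mat_diag_bdiag mat_adjoint_bdiag bdiag_mult mult_carrier_mat[of _ d d _ d])

text \<open>The eigenbases of the blocks, placed side by side, diagonalize the whole; the quotient
  of an index by \<open>d\<close> selects the block and the remainder the eigenvalue in it.\<close>

lemma spectral_form_bdiag:
  assumes "\<And>u. u < n \<Longrightarrow> spectral_form d (M u) (U u) (e u)"
  shows "spectral_form (n * d) (bdiag n d M) (bdiag n d U) (\<lambda>i. e (i div d) (i mod d))"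
proof -
  have U: "unitary_mat d (U u)" if "u < n" for u using assms[OF that] by (simp add: spectral_form_def)
  have "bdiag n d M = bdiag n d (\<lambda>u. U u * mat_diag d (\<lambda>i. complex_of_real (e u i)) * mat_adjoint (U u))"
    using assms by (intro bdiag_cong) (simp add: spectral_form_def)
  then show ?thesis
    using bdiag_conj_diag[of n d U "\<lambda>u i. complex_of_real (e u i)"] unitary_bdiag[of n d U] U
    by (simp add: spectral_form_def)
qed

lemma psd_spectral_form_choice:
  assumes "\<And>u. u < n \<Longrightarrow> psd d (M u)"
  shows "\<exists>U e. \<forall>u<n. spectral_form d (M u) (U u) (e u) \<and> (\<forall>i<d. 0 \<le> e u i)"
proof -
  have "\<forall>u. \<exists>U e. u < n \<longrightarrow> spectral_form d (M u) U e \<and> (\<forall>i<d. 0 \<le> e i)"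
    using assms by (metis psd_spectral_form)
  then show ?thesis by metis
qed

lemma psd_bdiag:
  assumes "\<And>u. u < n \<Longrightarrow> psd d (M u)"
  shows "psd (n * d) (bdiag n d M)"
proof -
  obtain U e where *: "\<forall>u<n. spectral_form d (M u) (U u) (e u) \<and> (\<forall>i<d. 0 \<le> e u i)"
    using psd_spectral_form_choice[of n d M] assms by blast
  then have s: "\<And>u. u < n \<Longrightarrow> spectral_form d (M u) (U u) (e u)" by blast
  show ?thesis
  proof (rule psd_spectral_formI[OF spectral_form_bdiag[OF s]])
    fix i assume "i < n * d"
    then show "0 \<le> e (i div d) (i mod d)" by (elim pair_index_cases) (simp add: *)
  qed
qed

lemma mat_log_bdiag:
  assumes "\<And>u. u < n \<Longrightarrow> psd d (M u)"
  shows "mat_log (bdiag n d M) = bdiag n d (\<lambda>u. mat_log (M u))"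
proof -
  obtain U e where *: "\<forall>u<n. spectral_form d (M u) (U u) (e u) \<and> (\<forall>i<d. 0 \<le> e u i)"
    using psd_spectral_form_choice[of n d M] assms by blast
  then have s: "\<And>u. u < n \<Longrightarrow> spectral_form d (M u) (U u) (e u)" by blast
  have "mat_log (bdiag n d M) = bdiag n d U * mat_diag (n * d)
      (\<lambda>i. complex_of_real (ln0 (e (i div d) (i mod d)))) * mat_adjoint (bdiag n d U)"
    by (rule mat_log_spectral_form[OF spectral_form_bdiag[OF s]])
  also have "\<dots> = bdiag n d (\<lambda>u. U u * mat_diag d (\<lambda>i. complex_of_real (ln0 (e u i))) * mat_adjoint (U u))"
    using bdiag_conj_diag[of n d U "\<lambda>u i. complex_of_real (ln0 (e u i))"] spectral_form_unitary[OF s] by simp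
  also have "\<dots> = bdiag n d (\<lambda>u. mat_log (M u))"
    by (rule bdiag_cong) (simp add: mat_log_spectral_form[OF s])
  finally show ?thesis .
qed

lemma mat_trace_bdiag:
  assumes "\<And>u. u < n \<Longrightarrow> M u \<in> carrier_mat d d"
  shows "mat_trace (bdiag n d M) = (\<Sum>u<n. mat_trace (M u))"
  using assms by (simp add: mat_trace_carrier[OF bdiag_carrier] mat_trace_carrier[of _ d d] sum_pair_index bdiag_index)

lemma mat_trace_bdiag_log:
  assumes "\<And>u. u < n \<Longrightarrow> psd d (M u)" "\<And>u. u < n \<Longrightarrow> psd d (L u)"
  shows "mat_trace (bdiag n d M * mat_log (bdiag n d L)) = (\<Sum>u<n. mat_trace (M u * mat_log (L u)))"
proof -
  have "M u \<in> carrier_mat d d" "mat_log (L u) \<in> carrier_mat d d" if "u < n" for u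
    using assms that by (auto simp: psd_carrier mat_log_carrier)
  then show ?thesis
    by (simp add: mat_log_bdiag[OF assms(2)] bdiag_mult mat_trace_bdiag mult_carrier_mat[of _ d d _ d])
qed

text \<open>A vector is annihilated by a block-diagonal matrix exactly when each of its slices of
  length \<open>d\<close> is annihilated by the corresponding block.\<close>

lemma mat_kernel_bdiag_mono:
  assumes "\<And>u. u < n \<Longrightarrow> M u \<in> carrier_mat d d" "\<And>u. u < n \<Longrightarrow> L u \<in> carrier_mat d d"
    and "\<And>u. u < n \<Longrightarrow> mat_kernel (L u) \<subseteq> mat_kernel (M u)"
  shows "mat_kernel (bdiag n d L) \<subseteq> mat_kernel (bdiag n d M)"
proof
  have row: "(\<Sum>j<n * d. bdiag n d K $$ (u * d + k, j) * v $ j) = (\<Sum>l<d. K u $$ (k, l) * v $ (u * d + l))"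
    if uk: "u < n" "k < d" for K :: "nat \<Rightarrow> complex mat" and u k v
  proof -
    have "(\<Sum>j<n * d. bdiag n d K $$ (u * d + k, j) * v $ j) =
      (\<Sum>w<n. if u = w then \<Sum>l<d. K u $$ (k, l) * v $ (u * d + l) else 0)"
      unfolding sum_pair_index using uk by (intro sum.cong) (auto simp: bdiag_index)
    then show ?thesis using uk by simp
  qed
  fix v assume "v \<in> mat_kernel (bdiag n d L)"
  then have v: "v \<in> carrier_vec (n * d)"
    and vL: "\<And>i. i < n * d \<Longrightarrow> (\<Sum>j<n * d. bdiag n d L $$ (i, j) * v $ j) = 0"
    by (auto simp: mat_kernel_iff[of _ "n * d"])
  have "(\<Sum>l<d. M u $$ (k, l) * v $ (u * d + l)) = 0" if uk: "u < n" "k < d" for u k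
  proof -
    have "vec d (\<lambda>l. v $ (u * d + l)) \<in> mat_kernel (L u)"
      unfolding mat_kernel_iff[OF assms(2)[OF uk(1)]]
      using vL[OF pair_index(3)[OF _ uk(1)]] uk(1) by (simp add: row)
    then have "vec d (\<lambda>l. v $ (u * d + l)) \<in> mat_kernel (M u)" using assms(3)[OF uk(1)] by blast
    then show ?thesis unfolding mat_kernel_iff[OF assms(1)[OF uk(1)]] using uk by simp
  qed
  then have "(\<Sum>j<n * d. bdiag n d M $$ (i, j) * v $ j) = 0" if "i < n * d" for i
    using that by (elim pair_index_cases) (simp add: row)
  then show "v \<in> mat_kernel (bdiag n d M)" using v by (simp add: mat_kernel_iff[of _ "n * d"])
qed

section \<open>Tensor products and partial traces\<close>

lemma tensor_mat_carrier [simp]: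
  "X \<in> carrier_mat n n \<Longrightarrow> Y \<in> carrier_mat m m \<Longrightarrow> tensor_mat X Y \<in> carrier_mat (n * m) (n * m)"
  by (auto simp: tensor_mat_def)

lemma dim_tensor_mat [simp]:
  "dim_row (tensor_mat X Y) = dim_row X * dim_row Y" "dim_col (tensor_mat X Y) = dim_col X * dim_col Y"
  by (simp_all add: tensor_mat_def)

lemma tensor_mat_index:
  assumes "X \<in> carrier_mat n n" "Y \<in> carrier_mat m m" "i < n" "j < n" "k < m" "l < m"
  shows "tensor_mat X Y $$ (i * m + k, j * m + l) = X $$ (i, j) * Y $$ (k, l)"
  using assms pair_index(1,2)[of k m i] pair_index(1,2)[of l m j] pair_index(3)[of k m i n]
    pair_index(3)[of l m j n] by (simp add: tensor_mat_def)

lemma pair_eq_matI: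
  assumes "A \<in> carrier_mat (n * m) (n * m)" "B \<in> carrier_mat (n * m) (n * m)"
    and "\<And>i j k l. i < n \<Longrightarrow> j < n \<Longrightarrow> k < m \<Longrightarrow> l < m \<Longrightarrow>
      A $$ (i * m + k, j * m + l) = B $$ (i * m + k, j * m + l)"
  shows "A = B"
proof (rule eq_matI)
  fix i j assume "i < dim_row B" "j < dim_col B"
  then have "i < n * m" "j < n * m" using assms(2) by auto
  then obtain u k v l where "u < n" "k < m" "i = u * m + k" "v < n" "l < m" "j = v * m + l"
    by (metis pair_index_cases)
  then show "A $$ (i, j) = B $$ (i, j)" by (simp add: assms(3))
qed (use assms in auto)

lemma tensor_mat_mult:
  assumes "A \<in> carrier_mat n n" "B \<in> carrier_mat m m" "C \<in> carrier_mat n n" "D \<in> carrier_mat m m"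
  shows "tensor_mat A B * tensor_mat C D = tensor_mat (A * C) (B * D)"
proof (rule pair_eq_matI[of _ n m])
  fix i j k l assume ij: "i < n" "j < n" "k < m" "l < m"
  have "(tensor_mat A B * tensor_mat C D) $$ (i * m + k, j * m + l) =
    (\<Sum>p<n. \<Sum>q<m. (A $$ (i, p) * C $$ (p, j)) * (B $$ (k, q) * D $$ (q, l)))"
    using assms ij
    by (subst index_mult_mat_sum[of _ "n * m" "n * m" _ "n * m"])
      (auto simp: pair_index sum_pair_index tensor_mat_index[of _ n _ m] intro!: sum.cong)
  also have "\<dots> = tensor_mat (A * C) (B * D) $$ (i * m + k, j * m + l)"
    using assms ij
    by (simp add: tensor_mat_index[of _ n _ m] mult_carrier_mat[of _ n n] mult_carrier_mat[of _ m m]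
        index_mult_mat_sum[of _ n n _ n] index_mult_mat_sum[of _ m m _ m] sum_product del: index_mult_mat(1))
  finally show "(tensor_mat A B * tensor_mat C D) $$ (i * m + k, j * m + l) =
      tensor_mat (A * C) (B * D) $$ (i * m + k, j * m + l)" .
qed (use assms in \<open>auto intro!: mult_carrier_mat tensor_mat_carrier\<close>)

lemma mat_adjoint_tensor:
  assumes "A \<in> carrier_mat n n" "B \<in> carrier_mat m m"
  shows "mat_adjoint (tensor_mat A B) = tensor_mat (mat_adjoint A) (mat_adjoint B)"
proof (rule pair_eq_matI[of _ n m])
  fix i j k l assume ij: "i < n" "j < n" "k < m" "l < m"
  then show "mat_adjoint (tensor_mat A B) $$ (i * m + k, j * m + l) =
      tensor_mat (mat_adjoint A) (mat_adjoint B) $$ (i * m + k, j * m + l)"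
    using assms ij by (simp add: tensor_mat_index[of _ n _ m] pair_index)
qed (use assms in auto)

text \<open>Brings the product of the marginals of a classical-quantum state, whose classical
  marginal is diagonal, into block form.\<close>

lemma tensor_mat_diag_left:
  assumes "Y \<in> carrier_mat d d"
  shows "tensor_mat (mat_diag n f) Y = bdiag n d (\<lambda>u. f u \<cdot>\<^sub>m Y)"
  by (rule bdiag_eqI) (use assms in \<open>auto simp: tensor_mat_index[of _ n _ d] mat_diag_def\<close>)

text \<open>Tensoring two diagonalizations gives a diagonalization with the products of the
  eigenvalues, which are nonnegative.\<close>

lemma psd_tensor:
  assumes "psd n X" "psd m Y"
  shows "psd (n * m) (tensor_mat X Y)"
proof -
  obtain U e where s: "spectral_form n X U e" and e: "\<And>i. i < n \<Longrightarrow> 0 \<le> e i"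
    using psd_spectral_form[OF assms(1)] by blast
  obtain V f where t: "spectral_form m Y V f" and f: "\<And>i. i < m \<Longrightarrow> 0 \<le> f i"
    using psd_spectral_form[OF assms(2)] by blast
  note u = unitary_matD[OF spectral_form_unitary[OF s]]
  note v = unitary_matD[OF spectral_form_unitary[OF t]]
  let ?D = "mat_diag n (\<lambda>i. complex_of_real (e i))" and ?E = "mat_diag m (\<lambda>i. complex_of_real (f i))"
  have one: "tensor_mat (1\<^sub>m n) (1\<^sub>m m) = (1\<^sub>m (n * m) :: complex mat)"
    by (rule pair_eq_matI[of _ n m]) (simp_all add: tensor_mat_index[of _ n _ m] pair_index pair_index_eq_iff)
  have diag: "tensor_mat ?D ?E = mat_diag (n * m) (\<lambda>i. complex_of_real (e (i div m) * f (i mod m)))"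
    unfolding tensor_mat_diag_left[OF mat_diag_dim]
    using mat_diag_bdiag[of n m "\<lambda>u k. complex_of_real (e u * f k)"]
    by (simp, intro bdiag_cong eq_matI) (auto simp: mat_diag_def)
  have "unitary_mat (n * m) (tensor_mat U V)"
    using u v one by (simp add: unitary_mat_def mat_adjoint_tensor[of _ n _ m] tensor_mat_mult[of _ n _ m])
  moreover have "tensor_mat X Y = tensor_mat U V * tensor_mat ?D ?E * mat_adjoint (tensor_mat U V)"
    using s t u v by (simp add: spectral_form_def mat_adjoint_tensor[of _ n _ m] tensor_mat_mult[of _ n _ m]
        mult_carrier_mat[of _ n n _ n] mult_carrier_mat[of _ m m _ m])
  ultimately have "spectral_form (n * m) (tensor_mat X Y) (tensor_mat U V) (\<lambda>i. e (i div m) * f (i mod m))"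
    unfolding diag by (simp add: spectral_form_def)
  then show ?thesis
  proof (rule psd_spectral_formI)
    fix i assume "i < n * m"
    then show "0 \<le> e (i div m) * f (i mod m)" by (elim pair_index_cases) (simp add: e f)
  qed
qed

lemma mat_trace_tensor:
  assumes "X \<in> carrier_mat n n" "Y \<in> carrier_mat m m"
  shows "mat_trace (tensor_mat X Y) = mat_trace X * mat_trace Y"
  using assms by (simp add: mat_trace_carrier[of _ n n] mat_trace_carrier[of _ m m]
      mat_trace_carrier[of _ "n * m" "n * m"] sum_pair_index tensor_mat_index[of _ n _ m] sum_product)

lemma state_tensor: "state n X \<Longrightarrow> state m Y \<Longrightarrow> state (n * m) (tensor_mat X Y)"
  by (auto simp: state_def psd_tensor mat_trace_tensor[OF psd_carrier psd_carrier])

section \<open>Positivity and order of partial traces\<close>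

lemma ptrace_carrier [simp]:
  "ptrace_snd a b X \<in> carrier_mat a a" "ptrace_fst a b X \<in> carrier_mat b b"
  by (simp_all add: ptrace_snd_def ptrace_fst_def)

lemma mat_trace_ptrace:
  assumes "X \<in> carrier_mat (a * b) (a * b)"
  shows "mat_trace (ptrace_snd a b X) = mat_trace X" "mat_trace (ptrace_fst a b X) = mat_trace X"
  using assms by (simp_all add: mat_trace_def ptrace_snd_def ptrace_fst_def sum_pair_index
      sum.swap[of _ "{..<a}" "{..<b}"])

text \<open>The form of the partial trace at \<open>f\<close> is the sum over \<open>k\<close> of
  the forms of \<open>X\<close> at the product vectors f \<otimes> |k>; \<open>g k\<close> is that
  vector in the joint indexing.\<close>

lemma psd_ptrace_snd:
  assumes X: "psd (a * b) X"
  shows "psd a (ptrace_snd a b X)"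
  unfolding psd_iff
proof (intro conjI allI impI)
  fix i j assume ij: "i < a" "j < a"
  have "X $$ (j * b + k, i * b + k) = cnj (X $$ (i * b + k, j * b + k))" if "k < b" for k
    by (rule psd_hermitian[OF X]) (simp_all add: pair_index ij that)
  then have "(\<Sum>k<b. X $$ (j * b + k, i * b + k)) = (\<Sum>k<b. cnj (X $$ (i * b + k, j * b + k)))"
    by (intro sum.cong) auto
  then show "ptrace_snd a b X $$ (j, i) = cnj (ptrace_snd a b X $$ (i, j))"
    using ij by (simp add: ptrace_snd_def)
next
  fix f :: "nat \<Rightarrow> complex"
  define g where "g k m = (if m mod b = k then f (m div b) else 0)" for k m
  have "(\<Sum>i<a. \<Sum>j<a. cnj (f i) * ptrace_snd a b X $$ (i, j) * f j) =
    (\<Sum>i<a. \<Sum>j<a. \<Sum>k<b. cnj (f i) * X $$ (i * b + k, j * b + k) * f j)"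
    by (simp add: ptrace_snd_def sum_distrib_left sum_distrib_right)
  also have "\<dots> = (\<Sum>i<a. \<Sum>k<b. \<Sum>j<a. cnj (f i) * X $$ (i * b + k, j * b + k) * f j)"
    by (intro sum.cong refl sum.swap)
  also have "\<dots> = (\<Sum>k<b. \<Sum>i<a. \<Sum>j<a. cnj (f i) * X $$ (i * b + k, j * b + k) * f j)"
    by (rule sum.swap)
  also have "\<dots> = (\<Sum>k<b. \<Sum>m<a * b. \<Sum>m'<a * b. cnj (g k m) * X $$ (m, m') * g k m')"
  proof (rule sum.cong[OF refl])
    fix k assume "k \<in> {..<b}"
    then have k: "k < b" by simp
    have "(\<Sum>m<a * b. \<Sum>m'<a * b. cnj (g k m) * X $$ (m, m') * g k m') =
      (\<Sum>i<a. \<Sum>q<b. \<Sum>j<a. \<Sum>q'<b. if q = k then if q' = k then cnj (f i) * X $$ (i * b + q, j * b + q') * f j else 0 else 0)"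
      unfolding sum_pair_index by (intro sum.cong refl) (auto simp: g_def pair_index)
    also have "\<dots> = (\<Sum>i<a. \<Sum>q<b. if q = k then \<Sum>j<a. \<Sum>q'<b. if q' = k then cnj (f i) * X $$ (i * b + q, j * b + q') * f j else 0 else 0)"
      by (intro sum.cong refl) auto
    also have "\<dots> = (\<Sum>i<a. \<Sum>j<a. cnj (f i) * X $$ (i * b + k, j * b + k) * f j)"
      using k by simp
    finally show "(\<Sum>i<a. \<Sum>j<a. cnj (f i) * X $$ (i * b + k, j * b + k) * f j) =
      (\<Sum>m<a * b. \<Sum>m'<a * b. cnj (g k m) * X $$ (m, m') * g k m')" by (rule sym)
  qed
  finally show "0 \<le> Re (\<Sum>i<a. \<Sum>j<a. cnj (f i) * ptrace_snd a b X $$ (i, j) * f j)"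
    using psd_quadratic_nonneg[OF X] by (simp only: Re_sum[of _ "{..<b}"] sum_nonneg)
qed simp

lemma psd_ptrace_fst:
  assumes X: "psd (a * b) X"
  shows "psd b (ptrace_fst a b X)"
  unfolding psd_iff
proof (intro conjI allI impI)
  fix i j assume ij: "i < b" "j < b"
  have "X $$ (k * b + j, k * b + i) = cnj (X $$ (k * b + i, k * b + j))" if "k < a" for k
    by (rule psd_hermitian[OF X]) (simp_all add: pair_index ij that)
  then have "(\<Sum>k<a. X $$ (k * b + j, k * b + i)) = (\<Sum>k<a. cnj (X $$ (k * b + i, k * b + j)))"
    by (intro sum.cong) auto
  then show "ptrace_fst a b X $$ (j, i) = cnj (ptrace_fst a b X $$ (i, j))"
    using ij by (simp add: ptrace_fst_def)
next
  fix f :: "nat \<Rightarrow> complex"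
  \<comment> \<open>The product vector |i> \<otimes> f, since the first factor is now the one traced
    out.\<close>
  define g where "g i m = (if m div b = i then f (m mod b) else 0)" for i m
  have "(\<Sum>k<b. \<Sum>l<b. cnj (f k) * ptrace_fst a b X $$ (k, l) * f l) =
    (\<Sum>k<b. \<Sum>l<b. \<Sum>i<a. cnj (f k) * X $$ (i * b + k, i * b + l) * f l)"
    by (simp add: ptrace_fst_def sum_distrib_left sum_distrib_right)
  also have "\<dots> = (\<Sum>k<b. \<Sum>i<a. \<Sum>l<b. cnj (f k) * X $$ (i * b + k, i * b + l) * f l)"
    by (intro sum.cong refl sum.swap)
  also have "\<dots> = (\<Sum>i<a. \<Sum>k<b. \<Sum>l<b. cnj (f k) * X $$ (i * b + k, i * b + l) * f l)"
    by (rule sum.swap)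
  also have "\<dots> = (\<Sum>i<a. \<Sum>m<a * b. \<Sum>m'<a * b. cnj (g i m) * X $$ (m, m') * g i m')"
  proof (rule sum.cong[OF refl])
    fix i assume "i \<in> {..<a}"
    then have i: "i < a" by simp
    have "(\<Sum>m<a * b. \<Sum>m'<a * b. cnj (g i m) * X $$ (m, m') * g i m') =
      (\<Sum>q<a. \<Sum>k<b. \<Sum>q'<a. if q' = i then \<Sum>l<b. if q = i then cnj (f k) * X $$ (q * b + k, q' * b + l) * f l else 0 else 0)"
      unfolding sum_pair_index by (intro sum.cong refl) (auto simp: g_def pair_index intro!: sum.cong)
    also have "\<dots> = (\<Sum>q<a. if q = i then \<Sum>k<b. \<Sum>l<b. cnj (f k) * X $$ (q * b + k, i * b + l) * f l else 0)"
      using i by (intro sum.cong refl) auto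
    also have "\<dots> = (\<Sum>k<b. \<Sum>l<b. cnj (f k) * X $$ (i * b + k, i * b + l) * f l)"
      using i by simp
    finally show "(\<Sum>k<b. \<Sum>l<b. cnj (f k) * X $$ (i * b + k, i * b + l) * f l) =
      (\<Sum>m<a * b. \<Sum>m'<a * b. cnj (g i m) * X $$ (m, m') * g i m')" by (rule sym)
  qed
  finally show "0 \<le> Re (\<Sum>k<b. \<Sum>l<b. cnj (f k) * ptrace_fst a b X $$ (k, l) * f l)"
    using psd_quadratic_nonneg[OF X] by (simp only: Re_sum[of _ "{..<a}"] sum_nonneg)
qed simp

lemma state_ptrace:
  assumes "state (a * b) X"
  shows "state a (ptrace_snd a b X)" "state b (ptrace_fst a b X)"
  using assms mat_trace_ptrace[of X a b] psd_carrier[of "a * b" X]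
  by (auto simp: state_def psd_ptrace_snd psd_ptrace_fst)

lemma ptrace_tensor:
  assumes "X \<in> carrier_mat n n" "Y \<in> carrier_mat m m"
  shows "ptrace_snd n m (tensor_mat X Y) = mat_trace Y \<cdot>\<^sub>m X"
    "ptrace_fst n m (tensor_mat X Y) = mat_trace X \<cdot>\<^sub>m Y"
  by (rule eq_matI; use assms in \<open>auto simp: ptrace_snd_def ptrace_fst_def tensor_mat_index[of _ n _ m]
      mat_trace_def sum_distrib_left sum_distrib_right mult_ac\<close>)+

text \<open>The flattened index is the same for both groupings of three factors, so regrouping
  leaves the matrix unchanged. Rewriting with it exchanges the two readings.\<close>

lemma triple_index: "(i * r + q) * b + k = i * (r * b) + (q * b + k)" for i r q b k :: nat
  by (simp add: algebra_simps)

lemma ptrace_snd_tensor: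
  assumes "P \<in> carrier_mat c c" "Y \<in> carrier_mat (r * a) (r * a)"
  shows "ptrace_snd (c * r) a (tensor_mat P Y) = tensor_mat P (ptrace_snd r a Y)"
proof (rule pair_eq_matI[of _ c r])
  fix i j q q' assume ij: "i < c" "j < c" "q < r" "q' < r"
  then show "ptrace_snd (c * r) a (tensor_mat P Y) $$ (i * r + q, j * r + q') =
      tensor_mat P (ptrace_snd r a Y) $$ (i * r + q, j * r + q')"
    using assms by (simp add: tensor_mat_index[of _ c _ r] ptrace_snd_def pair_index triple_index
        tensor_mat_index[of _ c _ "r * a"] sum_distrib_left)
qed (use assms in \<open>auto simp: ptrace_snd_def\<close>)

lemma ptrace_snd_ptrace_snd: "ptrace_snd c r (ptrace_snd (c * r) a X) = ptrace_snd c (r * a) X"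
  by (rule eq_matI) (auto simp: ptrace_snd_def sum_pair_index pair_index triple_index)

text \<open>The two outer factors can be traced out in either order; this identifies the reference
  marginal of the joint state with that of its \<open>RA\<close> part.\<close>

lemma ptrace_fst_ptrace_snd: "ptrace_fst c r (ptrace_snd (c * r) a X) = ptrace_snd r a (ptrace_fst c (r * a) X)"
  by (rule eq_matI) (auto simp: ptrace_snd_def ptrace_fst_def pair_index triple_index
      sum.swap[of _ "{..<c}" "{..<a}"])

lemma ptrace_bdiag:
  assumes "\<And>u. u < n \<Longrightarrow> M u \<in> carrier_mat d d"
  shows "ptrace_snd n d (bdiag n d M) = mat_diag n (\<lambda>u. mat_trace (M u))"
    "ptrace_fst n d (bdiag n d M) = mat d d (\<lambda>ij. \<Sum>u<n. M u $$ ij)"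
  by (rule eq_matI; use assms in \<open>auto simp: ptrace_snd_def ptrace_fst_def bdiag_index mat_diag_def mat_trace_def\<close>)+

lemma ptrace_snd_bdiag: "ptrace_snd (n * r) a (bdiag n (r * a) M) = bdiag n r (\<lambda>u. ptrace_snd r a (M u))"
  by (rule bdiag_eqI) (auto simp: ptrace_snd_def pair_index triple_index bdiag_index)

lemma ptrace_snd_smult: "X \<in> carrier_mat (r * a) (r * a) \<Longrightarrow> ptrace_snd r a (c \<cdot>\<^sub>m X) = c \<cdot>\<^sub>m ptrace_snd r a X"
  by (rule eq_matI) (auto simp: ptrace_snd_def pair_index sum_distrib_left)

lemma cq_state_bdiag:
  assumes "\<And>u. u < n \<Longrightarrow> \<rho> u \<in> carrier_mat d d"
  shows "cq_state n d p \<rho> = bdiag n d (\<lambda>u. complex_of_real (p u) \<cdot>\<^sub>m \<rho> u)"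
proof (rule bdiag_eqI)
  fix u v k l assume uv: "u < n" "v < n" "k < d" "l < d"
  have "cq_state n d p \<rho> $$ (u * d + k, v * d + l) =
    (\<Sum>w<n. complex_of_real (p w) * tensor_mat (basis_proj n w) (\<rho> w) $$ (u * d + k, v * d + l))"
    using uv by (simp add: cq_state_def pair_index)
  also have "\<dots> = (\<Sum>w<n. if u = w then if v = w then complex_of_real (p w) * \<rho> w $$ (k, l) else 0 else 0)"
    using uv assms
    by (intro sum.cong refl) (simp add: tensor_mat_index[of _ n _ d] basis_proj_def mat_diag_def)
  finally have "cq_state n d p \<rho> $$ (u * d + k, v * d + l) =
    (\<Sum>w<n. if u = w then if v = w then complex_of_real (p w) * \<rho> w $$ (k, l) else 0 else 0)" .
  then show "cq_state n d p \<rho> $$ (u * d + k, v * d + l) =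
      (if u = v then (complex_of_real (p u) \<cdot>\<^sub>m \<rho> u) $$ (k, l) else 0)"
    using uv assms[OF uv(1)] by auto
qed (simp add: cq_state_def)

section \<open>Channels\<close>

text \<open>The operator X_ij on the last factor in the expansion X = \<Sum>i j. |i><j| \<otimes>
  X_ij. The map \<open>id_tensor\<close> acts on these one at a time.\<close>

definition block :: "nat \<Rightarrow> complex mat \<Rightarrow> nat \<Rightarrow> nat \<Rightarrow> complex mat" where
  "block a X i j = mat a a (\<lambda>(k, l). X $$ (i * a + k, j * a + l))"

lemma block_carrier [simp]: "block a X i j \<in> carrier_mat a a"
  by (simp add: block_def)

lemma id_tensor_carrier [simp]: "id_tensor r a b N X \<in> carrier_mat (r * b) (r * b)"
  by (simp add: id_tensor_def)

lemma id_tensor_index: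
  assumes "i < r" "j < r" "k < b" "l < b"
  shows "id_tensor r a b N X $$ (i * b + k, j * b + l) = N (block a X i j) $$ (k, l)"
  using assms by (simp add: id_tensor_def pair_index block_def)

context
  fixes a b :: nat and N :: "complex mat \<Rightarrow> complex mat"
  assumes N: "channel a b N"
begin

lemma channel_carrier: "X \<in> carrier_mat a a \<Longrightarrow> N X \<in> carrier_mat b b"
  and channel_add: "X \<in> carrier_mat a a \<Longrightarrow> Y \<in> carrier_mat a a \<Longrightarrow> N (X + Y) = N X + N Y"
  and channel_smult: "X \<in> carrier_mat a a \<Longrightarrow> N (c \<cdot>\<^sub>m X) = c \<cdot>\<^sub>m N X"
  and channel_trace: "X \<in> carrier_mat a a \<Longrightarrow> mat_trace (N X) = mat_trace X"
  and channel_psd: "psd (r * a) Z \<Longrightarrow> psd (r * b) (id_tensor r a b N Z)"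
  using N unfolding channel_def by blast+

lemma channel_zero: "N (0\<^sub>m a a) = 0\<^sub>m b b"
proof -
  have "N (0 \<cdot>\<^sub>m 0\<^sub>m a a) = 0 \<cdot>\<^sub>m N (0\<^sub>m a a)" by (rule channel_smult) simp
  moreover have "N (0\<^sub>m a a) \<in> carrier_mat b b" by (rule channel_carrier) simp
  ultimately show ?thesis by (auto simp: mat_eq_iff)
qed

text \<open>Additivity for any number of summands, including none by way of
  \<open>channel_zero\<close>; it lets the channel pass through the sum in a partial trace.\<close>

lemma channel_sum:
  assumes "\<And>i. F i \<in> carrier_mat a a" "k < b" "l < b"
  shows "N (mat a a (\<lambda>ij. \<Sum>i<c. F i $$ ij)) $$ (k, l) = (\<Sum>i<c::nat. N (F i) $$ (k, l))"
proof (induction c)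
  case 0
  have "mat a a (\<lambda>ij. 0) = (0\<^sub>m a a :: complex mat)" by (rule eq_matI) auto
  then show ?case using assms channel_zero by simp
next
  case (Suc c)
  have "mat a a (\<lambda>ij. \<Sum>i<Suc c. F i $$ ij) = mat a a (\<lambda>ij. \<Sum>i<c. F i $$ ij) + F c"
    by (rule eq_matI) (use assms(1)[of c] in auto)
  then show ?case
    using Suc assms(2,3) channel_add[OF _ assms(1)[of c], of "mat a a (\<lambda>ij. \<Sum>i<c. F i $$ ij)"]
      channel_carrier[OF assms(1)[of c]] by simp
qed

lemma id_tensor_add_smult:
  assumes "X \<in> carrier_mat (r * a) (r * a)" "Y \<in> carrier_mat (r * a) (r * a)"
  shows "id_tensor r a b N (X + c \<cdot>\<^sub>m Y) = id_tensor r a b N X + c \<cdot>\<^sub>m id_tensor r a b N Y"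
proof (rule pair_eq_matI[of _ r b])
  fix i j k l assume ij: "i < r" "j < r" "k < b" "l < b"
  have "block a (X + c \<cdot>\<^sub>m Y) i j = block a X i j + c \<cdot>\<^sub>m block a Y i j"
    by (rule eq_matI) (use assms ij in \<open>auto simp: block_def pair_index\<close>)
  then show "id_tensor r a b N (X + c \<cdot>\<^sub>m Y) $$ (i * b + k, j * b + l) =
      (id_tensor r a b N X + c \<cdot>\<^sub>m id_tensor r a b N Y) $$ (i * b + k, j * b + l)"
    using ij channel_carrier[OF block_carrier, of Y i j] carrier_matD[OF id_tensor_carrier[of r a b N Y]]
    by (simp add: id_tensor_index pair_index channel_add channel_smult)
qed auto

lemma id_tensor_smult:
  assumes "Y \<in> carrier_mat (r * a) (r * a)"
  shows "id_tensor r a b N (c \<cdot>\<^sub>m Y) = c \<cdot>\<^sub>m id_tensor r a b N Y"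
proof (rule pair_eq_matI[of _ r b])
  fix i j k l assume ij: "i < r" "j < r" "k < b" "l < b"
  have "block a (c \<cdot>\<^sub>m Y) i j = c \<cdot>\<^sub>m block a Y i j"
    by (rule eq_matI) (use assms ij in \<open>auto simp: block_def pair_index\<close>)
  then show "id_tensor r a b N (c \<cdot>\<^sub>m Y) $$ (i * b + k, j * b + l) =
      (c \<cdot>\<^sub>m id_tensor r a b N Y) $$ (i * b + k, j * b + l)"
    using ij channel_carrier[OF block_carrier, of Y i j] carrier_matD[OF id_tensor_carrier[of r a b N Y]]
    by (simp add: id_tensor_index pair_index channel_smult)
qed auto

text \<open>Each entry of the reference marginal is the trace of a block, and the channel preserves
  traces. Equal reference marginals thus stay equal.\<close>

lemma ptrace_snd_id_tensor:
  assumes "X \<in> carrier_mat (r * a) (r * a)"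
  shows "ptrace_snd r b (id_tensor r a b N X) = ptrace_snd r a X"
proof (rule eq_matI)
  fix i j assume "i < dim_row (ptrace_snd r a X)" "j < dim_col (ptrace_snd r a X)"
  then have ij: "i < r" "j < r" by (auto simp: ptrace_snd_def)
  have "ptrace_snd r b (id_tensor r a b N X) $$ (i, j) = mat_trace (N (block a X i j))"
    using ij by (simp add: ptrace_snd_def id_tensor_index mat_trace_carrier[OF channel_carrier])
  also have "\<dots> = mat_trace (block a X i j)" by (simp add: channel_trace)
  also have "\<dots> = ptrace_snd r a X $$ (i, j)"
    using ij by (simp add: mat_trace_def block_def ptrace_snd_def)
  finally show "ptrace_snd r b (id_tensor r a b N X) $$ (i, j) = ptrace_snd r a X $$ (i, j)" .
qed (simp_all add: ptrace_snd_def)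

lemma state_id_tensor:
  assumes "state (r * a) X"
  shows "state (r * b) (id_tensor r a b N X)"
proof -
  have X: "X \<in> carrier_mat (r * a) (r * a)" using assms by (simp add: state_def psd_def)
  have "mat_trace (id_tensor r a b N X) = mat_trace X"
    using mat_trace_ptrace(1)[OF id_tensor_carrier, of r b a N X] mat_trace_ptrace(1)[OF X]
      ptrace_snd_id_tensor[OF X] by simp
  then show ?thesis using assms channel_psd by (simp add: state_def)
qed

text \<open>Tracing out the first factor adds up the blocks that share their reference indices, and
  the channel is linear.\<close>

lemma ptrace_fst_id_tensor:
  assumes "X \<in> carrier_mat (c * r * a) (c * r * a)"
  shows "ptrace_fst c (r * b) (id_tensor (c * r) a b N X) = id_tensor r a b N (ptrace_fst c (r * a) X)"
proof (rule pair_eq_matI[of _ r b])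
  fix i j k l assume ij: "i < r" "j < r" "k < b" "l < b"
  have "block a (ptrace_fst c (r * a) X) i j = mat a a (\<lambda>kl. \<Sum>q<c. block a X (q * r + i) (q * r + j) $$ kl)"
    by (rule eq_matI) (use ij in \<open>auto simp: block_def ptrace_fst_def pair_index triple_index\<close>)
  moreover have "ptrace_fst c (r * b) (id_tensor (c * r) a b N X) $$ (i * b + k, j * b + l) =
     (\<Sum>q<c. N (block a X (q * r + i) (q * r + j)) $$ (k, l))"
    using ij by (simp add: ptrace_fst_def pair_index id_tensor_index flip: triple_index)
  ultimately show "ptrace_fst c (r * b) (id_tensor (c * r) a b N X) $$ (i * b + k, j * b + l) =
      id_tensor r a b N (ptrace_fst c (r * a) X) $$ (i * b + k, j * b + l)"
    using ij by (simp add: id_tensor_index channel_sum)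
qed simp_all

text \<open>Blocks of the product are scalar multiples of blocks of \<open>Y\<close>, so homogeneity
  pulls \<open>P\<close> out. Together with the rules for marginals, the channel maps the product of
  the marginals of a state to the product of the marginals of its image.\<close>

lemma id_tensor_tensor:
  assumes P: "P \<in> carrier_mat c c" and Y: "Y \<in> carrier_mat (r * a) (r * a)"
  shows "id_tensor (c * r) a b N (tensor_mat P Y) = tensor_mat P (id_tensor r a b N Y)"
proof (rule pair_eq_matI[of _ "c * r" b])
  fix I J k l assume IJ: "I < c * r" "J < c * r" and kl: "k < b" "l < b"
  from IJ obtain i j q q' where ij: "i < c" "j < c" "q < r" "q' < r" and
    I: "I = i * r + q" and J: "J = j * r + q'" by (metis pair_index_cases)
  have "block a (tensor_mat P Y) I J = P $$ (i, j) \<cdot>\<^sub>m block a Y q q'"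
    unfolding I J
    by (rule eq_matI) (use assms ij in \<open>auto simp: block_def triple_index pair_index tensor_mat_index[of _ c _ "r * a"]\<close>)
  then have "id_tensor (c * r) a b N (tensor_mat P Y) $$ (I * b + k, J * b + l) = P $$ (i, j) * N (block a Y q q') $$ (k, l)"
    using IJ kl channel_carrier[OF block_carrier, of Y q q'] by (simp add: id_tensor_index channel_smult)
  also have "\<dots> = tensor_mat P (id_tensor r a b N Y) $$ (I * b + k, J * b + l)"
    unfolding I J triple_index using P ij kl
    by (simp add: tensor_mat_index[of _ c _ "r * b"] pair_index id_tensor_index)
  finally show "id_tensor (c * r) a b N (tensor_mat P Y) $$ (I * b + k, J * b + l) =
     tensor_mat P (id_tensor r a b N Y) $$ (I * b + k, J * b + l)" .
next
  show "tensor_mat P (id_tensor r a b N Y) \<in> carrier_mat (c * r * b) (c * r * b)"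
    using tensor_mat_carrier[OF P id_tensor_carrier] by (simp add: mult.assoc)
qed simp

lemma id_tensor_bdiag:
  "id_tensor (n * r) a b N (bdiag n (r * a) M) = bdiag n (r * b) (\<lambda>u. id_tensor r a b N (M u))"
proof (rule pair_eq_matI[of _ "n * r" b])
  fix I J k l assume IJ: "I < n * r" "J < n * r" and kl: "k < b" "l < b"
  from IJ obtain i j q q' where ij: "i < n" "j < n" "q < r" "q' < r" and
    I: "I = i * r + q" and J: "J = j * r + q'" by (metis pair_index_cases)
  have "block a (bdiag n (r * a) M) I J = (if i = j then block a (M i) q q' else 0\<^sub>m a a)"
    unfolding I J
    by (rule eq_matI) (use ij in \<open>auto simp: block_def triple_index pair_index bdiag_index\<close>)
  then have "id_tensor (n * r) a b N (bdiag n (r * a) M) $$ (I * b + k, J * b + l) =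
     (if i = j then N (block a (M i) q q') $$ (k, l) else 0)"
    using IJ kl by (simp add: id_tensor_index channel_zero)
  also have "\<dots> = bdiag n (r * b) (\<lambda>u. id_tensor r a b N (M u)) $$ (I * b + k, J * b + l)"
    unfolding I J triple_index using ij kl
    by (simp add: bdiag_index pair_index id_tensor_index)
  finally show "id_tensor (n * r) a b N (bdiag n (r * a) M) $$ (I * b + k, J * b + l) =
     bdiag n (r * b) (\<lambda>u. id_tensor r a b N (M u)) $$ (I * b + k, J * b + l)" .
next
  show "bdiag n (r * b) (\<lambda>u. id_tensor r a b N (M u)) \<in> carrier_mat (n * r * b) (n * r * b)"
    using bdiag_carrier[of n "r * b"] by (simp add: mult.assoc)
qed simp

lemma id_tensor_cq_state:
  assumes "\<And>u. u < n \<Longrightarrow> \<rho> u \<in> carrier_mat (r * a) (r * a)"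
  shows "id_tensor (n * r) a b N (cq_state n (r * a) p \<rho>) = cq_state n (r * b) p (\<lambda>u. id_tensor r a b N (\<rho> u))"
  using assms by (simp add: cq_state_bdiag id_tensor_bdiag id_tensor_smult cong: bdiag_cong)

text \<open>A linear map gives no direct control over kernels, so the inclusion is turned into an
  operator inequality, transported, and turned back. It guarantees that \<open>rel_ent\<close> of
  the outputs is their relative entropy.\<close>

lemma mat_kernel_id_tensor_mono:
  assumes r: "psd (r * a) \<rho>" and s: "psd (r * a) \<sigma>" and ker: "mat_kernel \<sigma> \<subseteq> mat_kernel \<rho>"
  shows "mat_kernel (id_tensor r a b N \<sigma>) \<subseteq> mat_kernel (id_tensor r a b N \<rho>)"
proof -
  note C = psd_carrier[OF r] psd_carrier[OF s]
  obtain c where c: "psd (r * a) (complex_of_real c \<cdot>\<^sub>m \<sigma> - \<rho>)"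
    using psd_dominated_of_kernel[OF r s ker] by blast
  have "complex_of_real c \<cdot>\<^sub>m \<sigma> - \<rho> = complex_of_real c \<cdot>\<^sub>m \<sigma> + (-1) \<cdot>\<^sub>m \<rho>"
    by (rule eq_matI) (use C in auto)
  then have "id_tensor r a b N (complex_of_real c \<cdot>\<^sub>m \<sigma> - \<rho>) =
      complex_of_real c \<cdot>\<^sub>m id_tensor r a b N \<sigma> + (-1) \<cdot>\<^sub>m id_tensor r a b N \<rho>"
    using C by (simp add: id_tensor_add_smult id_tensor_smult)
  also have "\<dots> = complex_of_real c \<cdot>\<^sub>m id_tensor r a b N \<sigma> - id_tensor r a b N \<rho>"
    by (rule eq_matI) (auto simp: id_tensor_def)
  finally have "psd (r * b) (complex_of_real c \<cdot>\<^sub>m id_tensor r a b N \<sigma> - id_tensor r a b N \<rho>)"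
    using channel_psd[OF c] by simp
  then show ?thesis using channel_psd[OF r] channel_psd[OF s] by (rule mat_kernel_mono_of_dominated[rotated 2])
qed

end

section \<open>Mutual information of classical-quantum states\<close>

lemma rel_entropy_of_kernel:
  assumes "psd d \<rho>" "psd d \<sigma>" "mat_kernel \<sigma> \<subseteq> mat_kernel \<rho>"
  shows "rel_entropy \<rho> \<sigma> = ereal (rel_ent \<rho> \<sigma>)"
  using mat_supp_mono[OF _ assms(3)] psd_carrier[OF assms(1)] psd_carrier[OF assms(2)]
  by (simp add: rel_entropy_def rel_ent_def)

lemma kernel_of_rel_entropy:
  assumes "psd d \<rho>" "psd d \<sigma>" "rel_entropy \<rho> \<sigma> < \<infinity>"
  shows "mat_kernel \<sigma> \<subseteq> mat_kernel \<rho>"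
  using assms(3) mat_kernel_mono_of_supp[OF assms(1,2)] by (simp add: rel_entropy_def split: if_splits)

lemma rel_entropy_self:
  assumes "psd d \<rho>"
  shows "rel_entropy \<rho> \<rho> = 0"
  using rel_entropy_of_kernel[OF assms assms subset_refl] rel_ent_diff[OF assms assms]
  by (simp add: zero_ereal_def)

lemma mat_kernel_smult:
  fixes X :: "complex mat"
  assumes "X \<in> carrier_mat d d" "c \<noteq> 0"
  shows "mat_kernel (c \<cdot>\<^sub>m X) = mat_kernel X"
proof -
  have "(\<Sum>j<d. (c \<cdot>\<^sub>m X) $$ (i, j) * v $ j) = c * (\<Sum>j<d. X $$ (i, j) * v $ j)" if "i < d" for i and v :: "complex vec"
    using that assms(1) by (simp add: sum_distrib_left mult.assoc)
  then show ?thesis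
    using assms by (auto simp: mat_kernel_iff[of X d] mat_kernel_iff[of "c \<cdot>\<^sub>m X" d])
qed

text \<open>With logarithms set to 0 on the kernel, log (c Y) = (ln c) + log Y holds only on the
  support of \<open>Y\<close>. On the kernel of \<open>Y\<close> the expectation of \<open>X\<close>
  vanishes by the kernel inclusion, so the rule is true under the trace.\<close>

lemma mat_trace_log_scale:
  assumes X: "psd d X" and Y: "psd d Y" and ker: "mat_kernel Y \<subseteq> mat_kernel X" and c: "0 < c"
  shows "mat_trace ((complex_of_real c \<cdot>\<^sub>m X) * mat_log (complex_of_real c \<cdot>\<^sub>m Y)) =
    complex_of_real c * (complex_of_real (ln c) * mat_trace X + mat_trace (X * mat_log Y))"
proof -
  obtain V f where s: "spectral_form d Y V f" and f: "\<And>i. i < d \<Longrightarrow> 0 \<le> f i"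
    using psd_spectral_form[OF Y] by blast
  obtain U e where r: "spectral_form d X U e" using psd_spectral_form[OF X] by blast
  note XC = psd_carrier[OF X]
  have "psd d (complex_of_real c \<cdot>\<^sub>m Y)" using psd_smult[OF Y] c by simp
  then have L: "mat_log (complex_of_real c \<cdot>\<^sub>m Y) \<in> carrier_mat d d" by (rule mat_log_carrier)
  have "mat_trace (X * mat_log (complex_of_real c \<cdot>\<^sub>m Y)) =
      (\<Sum>j<d. diag_entry V X j * complex_of_real (ln0 (c * f j)))"
    by (rule mat_trace_mult_log[OF spectral_form_smult[OF s] XC])
  also have "\<dots> = (\<Sum>j<d. complex_of_real (ln c) * diag_entry V X j + diag_entry V X j * complex_of_real (ln0 (f j)))"
  proof (rule sum.cong[OF refl])
    fix j assume "j \<in> {..<d}"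
    then have j: "j < d" by simp
    show "diag_entry V X j * complex_of_real (ln0 (c * f j)) =
      complex_of_real (ln c) * diag_entry V X j + diag_entry V X j * complex_of_real (ln0 (f j))"
    proof (cases "f j = 0")
      case True
      then show ?thesis using overlap_kernel(2)[OF X r s ker j j] by simp
    next
      case False
      then have "0 < f j" using f[OF j] by simp
      then show ?thesis using c by (simp add: ln0_pos ln_mult algebra_simps)
    qed
  qed
  also have "\<dots> = complex_of_real (ln c) * mat_trace X + mat_trace (X * mat_log Y)"
    by (simp add: sum.distrib mat_trace_mult_log[OF s XC] sum_diag_entry[OF spectral_form_unitary[OF s] XC]
        flip: sum_distrib_left)
  finally show ?thesis
    using XC L by (simp add: mult_smult_assoc_mat[of _ d d _ d] mat_trace_smult[of _ d] mult_carrier_mat[of _ d d _ d])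
qed

text \<open>This is the Holevo quantity. The state and the product of its marginals are block
  diagonal with blocks p_u \<rho>_u and p_u \<omega>, and the contributions ln p_u from scaling the
  two logarithms cancel in each block.\<close>

lemma mutual_info_cq_state:
  assumes st: "\<And>u. u < n \<Longrightarrow> state d (\<rho> u)" and p: "\<And>u. u < n \<Longrightarrow> 0 < p u"
    and \<omega>: "\<omega> = mat d d (\<lambda>ij. \<Sum>u<n. complex_of_real (p u) * \<rho> u $$ ij)"
    and \<omega>s: "state d \<omega>" and ker: "\<And>u. u < n \<Longrightarrow> mat_kernel \<omega> \<subseteq> mat_kernel (\<rho> u)"
  shows "mutual_info n d (cq_state n d p \<rho>) = ereal (\<Sum>u<n. p u * rel_ent (\<rho> u) \<omega>)"
proof -
  have P: "psd d (\<rho> u)" and tr: "mat_trace (\<rho> u) = 1" if "u < n" for u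
    using st[OF that] by (auto simp: state_def)
  have \<omega>p: "psd d \<omega>" and \<omega>t: "mat_trace \<omega> = 1" using \<omega>s by (auto simp: state_def)
  note C = psd_carrier[OF P] and \<omega>C = psd_carrier[OF \<omega>p]
  let ?M = "\<lambda>u. complex_of_real (p u) \<cdot>\<^sub>m \<rho> u" and ?L = "\<lambda>u. complex_of_real (p u) \<cdot>\<^sub>m \<omega>"
  have MP: "psd d (?M u)" and LP: "psd d (?L u)" if "u < n" for u
    using that p[OF that] P \<omega>p by (auto intro!: psd_smult)
  have cq: "cq_state n d p \<rho> = bdiag n d ?M" using C by (rule cq_state_bdiag)
  have "ptrace_snd n d (bdiag n d ?M) = mat_diag n (\<lambda>u. mat_trace (?M u))"
    by (rule ptrace_bdiag(1)[OF psd_carrier[OF MP]])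
  also have "\<dots> = mat_diag n (\<lambda>u. complex_of_real (p u))"
    by (rule eq_matI) (use C tr in \<open>auto simp: mat_diag_def mat_trace_smult[of _ d]\<close>)
  finally have m1: "ptrace_snd n d (bdiag n d ?M) = \<dots>" .
  have "ptrace_fst n d (bdiag n d ?M) = mat d d (\<lambda>ij. \<Sum>u<n. ?M u $$ ij)"
    by (rule ptrace_bdiag(2)[OF psd_carrier[OF MP]])
  also have "\<dots> = \<omega>" unfolding \<omega>
    by (rule eq_matI) (auto simp: carrier_matD[OF C] intro!: sum.cong)
  finally have m2: "ptrace_fst n d (bdiag n d ?M) = \<omega>" .
  have "mat_kernel (?L u) \<subseteq> mat_kernel (?M u)" if u: "u < n" for u
    using ker[OF u] p[OF u] mat_kernel_smult[OF C[OF u]] mat_kernel_smult[OF \<omega>C] by simp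
  then have k: "mat_kernel (bdiag n d ?L) \<subseteq> mat_kernel (bdiag n d ?M)"
    by (intro mat_kernel_bdiag_mono psd_carrier[OF MP] psd_carrier[OF LP])
  have term_u: "Re (mat_trace (?M u * mat_log (?M u))) - Re (mat_trace (?M u * mat_log (?L u))) =
      p u * rel_ent (\<rho> u) \<omega>" if u: "u < n" for u
    using mat_trace_log_scale[OF P[OF u] P[OF u] subset_refl p[OF u]]
      mat_trace_log_scale[OF P[OF u] \<omega>p ker[OF u] p[OF u]]
    by (simp add: rel_ent_diff[OF P[OF u] \<omega>p] right_diff_distrib distrib_left)
  have "mutual_info n d (cq_state n d p \<rho>) = rel_entropy (bdiag n d ?M) (bdiag n d ?L)"
    unfolding mutual_info_def cq m1 m2 by (simp add: tensor_mat_diag_left[OF \<omega>C])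
  also have "\<dots> = ereal (rel_ent (bdiag n d ?M) (bdiag n d ?L))"
    by (intro rel_entropy_of_kernel[OF psd_bdiag psd_bdiag k] MP LP)
  also have "rel_ent (bdiag n d ?M) (bdiag n d ?L) = (\<Sum>u<n. p u * rel_ent (\<rho> u) \<omega>)"
  proof -
    have "mat_trace (bdiag n d ?M * mat_log (bdiag n d ?M)) = (\<Sum>u<n. mat_trace (?M u * mat_log (?M u)))"
      by (rule mat_trace_bdiag_log[OF MP MP])
    moreover have "mat_trace (bdiag n d ?M * mat_log (bdiag n d ?L)) = (\<Sum>u<n. mat_trace (?M u * mat_log (?L u)))"
      by (rule mat_trace_bdiag_log[OF MP LP])
    moreover have "psd (n * d) (bdiag n d ?M)" by (rule psd_bdiag[OF MP])
    moreover have "psd (n * d) (bdiag n d ?L)" by (rule psd_bdiag[OF LP])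
    ultimately have "rel_ent (bdiag n d ?M) (bdiag n d ?L) =
        (\<Sum>u<n. Re (mat_trace (?M u * mat_log (?M u))) - Re (mat_trace (?M u * mat_log (?L u))))"
      by (simp add: rel_ent_diff[of "n * d"] sum_subtractf)
    then show ?thesis using term_u by simp
  qed
  finally show ?thesis .
qed

section \<open>Two states mixed by a classical bit\<close>

lemma mat_trace_mix_mult:
  assumes "\<rho> \<in> carrier_mat d d" "\<sigma> \<in> carrier_mat d d" "L \<in> carrier_mat d d"
  shows "mat_trace (mix t \<rho> \<sigma> * L) =
    complex_of_real t * mat_trace (\<rho> * L) + complex_of_real (1 - t) * mat_trace (\<sigma> * L)"
  using assms by (simp add: mix_def add_mult_distrib_mat[of _ d d _ _ d] mult_smult_assoc_mat[of _ d d _ d]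
      mat_trace_add[of _ d] mat_trace_smult[of _ d] mult_carrier_mat[of _ d d _ d])

text \<open>The mixture dominates t \<rho> and (1 - t) \<sigma>: the differences are multiples of
  the other state. Strict bounds on \<open>t\<close> allow division by both weights.\<close>

lemma mat_kernel_mix_le:
  assumes r: "psd d \<rho>" and s: "psd d \<sigma>" and t: "0 < t" "t < 1"
  shows "mat_kernel (mix t \<rho> \<sigma>) \<subseteq> mat_kernel \<rho>" "mat_kernel (mix t \<rho> \<sigma>) \<subseteq> mat_kernel \<sigma>"
proof -
  note C = psd_carrier[OF r] psd_carrier[OF s]
  have m: "psd d (mix t \<rho> \<sigma>)" unfolding mix_def using r s t by (intro psd_add psd_smult) auto
  have "complex_of_real (1 / t) \<cdot>\<^sub>m mix t \<rho> \<sigma> - \<rho> = complex_of_real ((1 - t) / t) \<cdot>\<^sub>m \<sigma>"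
    by (rule eq_matI) (use C t in \<open>auto simp: mix_def field_simps\<close>)
  moreover have "psd d (complex_of_real ((1 - t) / t) \<cdot>\<^sub>m \<sigma>)" using t by (intro psd_smult[OF s]) simp
  ultimately have "psd d (complex_of_real (1 / t) \<cdot>\<^sub>m mix t \<rho> \<sigma> - \<rho>)" by (simp only:)
  then show "mat_kernel (mix t \<rho> \<sigma>) \<subseteq> mat_kernel \<rho>" by (rule mat_kernel_mono_of_dominated[OF r m])
  have "complex_of_real (1 / (1 - t)) \<cdot>\<^sub>m mix t \<rho> \<sigma> - \<sigma> = complex_of_real (t / (1 - t)) \<cdot>\<^sub>m \<rho>"
    by (rule eq_matI) (use C t in \<open>auto simp: mix_def field_simps\<close>)
  moreover have "psd d (complex_of_real (t / (1 - t)) \<cdot>\<^sub>m \<rho>)" using t by (intro psd_smult[OF r]) simp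
  ultimately have "psd d (complex_of_real (1 / (1 - t)) \<cdot>\<^sub>m mix t \<rho> \<sigma> - \<sigma>)" by (simp only:)
  then show "mat_kernel (mix t \<rho> \<sigma>) \<subseteq> mat_kernel \<sigma>" by (rule mat_kernel_mono_of_dominated[OF s m])
qed

definition binary :: "'a \<Rightarrow> 'a \<Rightarrow> nat \<Rightarrow> 'a" where
  "binary x y u = (if u = 0 then x else y)"

text \<open>Donald's identity.\<close>

lemma mutual_info_binary:
  assumes r: "state d \<rho>" and s: "state d \<sigma>" and t: "0 < t" "t < 1"
  shows "mutual_info 2 d (cq_state 2 d (binary t (1 - t)) (binary \<rho> \<sigma>)) =
    ereal (t * rel_ent \<rho> \<sigma> - rel_ent (mix t \<rho> \<sigma>) \<sigma>)"
proof -
  have P: "psd d \<rho>" "psd d \<sigma>" using r s by (auto simp: state_def)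
  have ms: "state d (mix t \<rho> \<sigma>)" using r s t by (intro state_mix) auto
  then have m: "psd d (mix t \<rho> \<sigma>)" by (simp add: state_def)
  note C = psd_carrier[OF P(1)] psd_carrier[OF P(2)]
  have "mutual_info 2 d (cq_state 2 d (binary t (1 - t)) (binary \<rho> \<sigma>)) =
    ereal (\<Sum>u<2. binary t (1 - t) u * rel_ent (binary \<rho> \<sigma> u) (mix t \<rho> \<sigma>))"
  proof (rule mutual_info_cq_state[OF _ _ _ ms])
    show "mix t \<rho> \<sigma> = mat d d (\<lambda>ij. \<Sum>u<2. complex_of_real (binary t (1 - t) u) * binary \<rho> \<sigma> u $$ ij)"
      by (rule eq_matI) (use C in \<open>auto simp: mix_def binary_def numeral_2_eq_2\<close>)
  qed (use r s t mat_kernel_mix_le[OF P t] in \<open>auto simp: binary_def\<close>)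
  also have "(\<Sum>u<2. binary t (1 - t) u * rel_ent (binary \<rho> \<sigma> u) (mix t \<rho> \<sigma>)) =
      t * rel_ent \<rho> (mix t \<rho> \<sigma>) + (1 - t) * rel_ent \<sigma> (mix t \<rho> \<sigma>)"
    by (simp add: binary_def numeral_2_eq_2)
  \<comment> \<open>By linearity of the mixture the two traces against its logarithm combine into
    one, which also occurs in the relative entropy from the mixture to \<sigma>; the traces of
    \<sigma> against its own logarithm cancel.\<close>
  also have "\<dots> = t * rel_ent \<rho> \<sigma> - rel_ent (mix t \<rho> \<sigma>) \<sigma>"
    unfolding rel_ent_diff[OF P(1) m] rel_ent_diff[OF P(2) m] rel_ent_diff[OF P] rel_ent_diff[OF m P(2)]
      mat_trace_mix_mult[OF C mat_log_carrier[OF m]] mat_trace_mix_mult[OF C mat_log_carrier[OF P(2)]]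
    by (simp add: algebra_simps)
  finally show ?thesis .
qed

text \<open>Nonnegativity of the correction gives the upper bound and its quadratic estimate the
  lower one. Inputs and outputs need this sandwich separately, each with its own constant.\<close>

lemma mutual_info_binary_bounds:
  assumes r: "state d \<rho>" and s: "state d \<sigma>" and ker: "mat_kernel \<sigma> \<subseteq> mat_kernel \<rho>"
  obtains I C where "\<And>t. 0 < t \<Longrightarrow> t < 1 \<Longrightarrow>
      mutual_info 2 d (cq_state 2 d (binary t (1 - t)) (binary \<rho> \<sigma>)) = ereal (I t)"
    "\<And>t. 0 < t \<Longrightarrow> t < 1 \<Longrightarrow> rel_ent \<rho> \<sigma> - C * t \<le> I t / t"
    "\<And>t. 0 < t \<Longrightarrow> t < 1 \<Longrightarrow> I t / t \<le> rel_ent \<rho> \<sigma>"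
proof -
  obtain C where C: "\<And>t. 0 \<le> t \<Longrightarrow> t \<le> 1 \<Longrightarrow> rel_ent (mix t \<rho> \<sigma>) \<sigma> \<le> C * t\<^sup>2"
    using rel_ent_mix_quadratic[OF r s ker] by blast
  show thesis
  proof (rule that[of "\<lambda>t. t * rel_ent \<rho> \<sigma> - rel_ent (mix t \<rho> \<sigma>) \<sigma>" C])
    fix t :: real assume t: "0 < t" "t < 1"
    show "mutual_info 2 d (cq_state 2 d (binary t (1 - t)) (binary \<rho> \<sigma>)) =
        ereal (t * rel_ent \<rho> \<sigma> - rel_ent (mix t \<rho> \<sigma>) \<sigma>)"
      by (rule mutual_info_binary[OF r s t])
    show "rel_ent \<rho> \<sigma> - C * t \<le> (t * rel_ent \<rho> \<sigma> - rel_ent (mix t \<rho> \<sigma>) \<sigma>) / t"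
      using C[of t] t by (simp add: field_simps power2_eq_square)
    have "0 \<le> rel_ent (mix t \<rho> \<sigma>) \<sigma>"
      using r s t ker by (intro rel_ent_nonneg state_mix mat_kernel_mix psd_carrier) (auto simp: state_def)
    then show "(t * rel_ent \<rho> \<sigma> - rel_ent (mix t \<rho> \<sigma>) \<sigma>) / t \<le> rel_ent \<rho> \<sigma>"
      using t by (simp add: field_simps)
  qed
qed

lemma tendsto_at_right_of_linear_bounds:
  fixes f :: "real \<Rightarrow> real"
  assumes "\<And>t. 0 < t \<Longrightarrow> t < 1 \<Longrightarrow> D - C * t \<le> f t" "\<And>t. 0 < t \<Longrightarrow> t < 1 \<Longrightarrow> f t \<le> D"
  shows "(f \<longlongrightarrow> D) (at_right 0)"
proof (rule tendsto_sandwich)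
  have ev: "\<forall>\<^sub>F t in at_right (0::real). 0 < t \<and> t < 1"
    unfolding eventually_at_right_field by (intro exI[of _ 1]) auto
  show "\<forall>\<^sub>F t in at_right 0. D - C * t \<le> f t" "\<forall>\<^sub>F t in at_right 0. f t \<le> D"
    using ev by (eventually_elim; simp add: assms)+
  show "((\<lambda>t. D - C * t) \<longlongrightarrow> D) (at_right 0)"
    by (rule tendsto_eq_intros refl | simp)+
qed simp

section \<open>Comparison of the coefficients\<close>

text \<open>The set inside \<open>ratio_sup\<close> under a name of its own, so that coefficients
  can be compared by inclusion before the default value for the empty set enters.\<close>

definition ratios :: "(ereal \<times> ereal) set \<Rightarrow> ereal set" where
  "ratios S = {x / y | x y. (x, y) \<in> S \<and> 0 < y \<and> y < \<infinity>}"

lemma ratio_sup_ratios: "ratio_sup S = (if ratios S = {} then 0 else Sup (ratios S))"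
  unfolding ratio_sup_def ratios_def Let_def ..

text \<open>Positivity of the denominator is at hand when membership in \<open>T\<close> is shown: a
  product state would give equal \<rho> and \<sigma>, which \<open>complete_pairs\<close>
  excludes.\<close>

lemma ratios_mono:
  assumes "\<And>x y. (x, y) \<in> S \<Longrightarrow> 0 < y \<Longrightarrow> (x, y) \<in> T"
  shows "ratios S \<subseteq> ratios T"
  using assms by (auto simp: ratios_def)

context
  fixes a b :: nat and N :: "complex mat \<Rightarrow> complex mat"
  assumes N: "channel a b N"
begin

abbreviation "complete_pairs \<equiv>
  {(rel_entropy (id_tensor r a b N \<rho>) (id_tensor r a b N \<sigma>), rel_entropy \<rho> \<sigma>) | r \<rho> \<sigma>.
     state (r * a) \<rho> \<and> state (r * a) \<sigma> \<and> \<rho> \<noteq> \<sigma> \<and> ptrace_snd r a \<rho> = ptrace_snd r a \<sigma>}"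

abbreviation "MIR_pairs \<equiv>
  {(mutual_info c (r * b) (id_tensor (c * r) a b N \<rho>), mutual_info c (r * a) \<rho>) | c r \<rho>.
     state (c * r * a) \<rho> \<and>
     (let \<rho>CR = ptrace_snd (c * r) a \<rho>
      in \<rho>CR = tensor_mat (ptrace_snd c r \<rho>CR) (ptrace_fst c r \<rho>CR))}"

lemma MIR_ratios_subset: "ratios MIR_pairs \<subseteq> ratios complete_pairs"
proof (rule ratios_mono)
  fix x y assume "(x, y) \<in> MIR_pairs" and y0: "0 < y"
  then obtain c r \<rho> where x: "x = mutual_info c (r * b) (id_tensor (c * r) a b N \<rho>)"
    and y: "y = mutual_info c (r * a) \<rho>" and st: "state (c * r * a) \<rho>"
    and prd: "ptrace_snd (c * r) a \<rho> =
      tensor_mat (ptrace_snd c r (ptrace_snd (c * r) a \<rho>)) (ptrace_fst c r (ptrace_snd (c * r) a \<rho>))"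
    unfolding Let_def by blast
  have st': "state (c * (r * a)) \<rho>" using st by (simp add: mult.assoc)
  have \<rho>C: "\<rho> \<in> carrier_mat (c * r * a) (c * r * a)" using st by (simp add: state_def psd_def)
  define \<sigma> where "\<sigma> = tensor_mat (ptrace_snd c (r * a) \<rho>) (ptrace_fst c (r * a) \<rho>)"
  have \<sigma>s: "state (c * r * a) \<sigma>"
    using state_tensor[OF state_ptrace[OF st']] by (simp add: \<sigma>_def mult.assoc)
  \<comment> \<open>The marginal on \<open>C\<close> is reached through \<open>CR\<close>, on which
    the channel acts trivially.\<close>
  have "ptrace_snd c (r * b) (id_tensor (c * r) a b N \<rho>) = ptrace_snd c (r * a) \<rho>"
    using ptrace_snd_ptrace_snd[of c r b "id_tensor (c * r) a b N \<rho>"] ptrace_snd_id_tensor[OF N \<rho>C]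
      ptrace_snd_ptrace_snd[of c r a \<rho>] by simp
  then have x': "x = rel_entropy (id_tensor (c * r) a b N \<rho>) (id_tensor (c * r) a b N \<sigma>)"
    unfolding x mutual_info_def \<sigma>_def by (simp add: ptrace_fst_id_tensor[OF N \<rho>C] id_tensor_tensor[OF N])
  have y': "y = rel_entropy \<rho> \<sigma>" unfolding y mutual_info_def \<sigma>_def ..
  \<comment> \<open>Equality would make the denominator 0.\<close>
  have "\<rho> \<noteq> \<sigma>" using y0 rel_entropy_self[of "c * r * a" \<rho>] st unfolding y' by (auto simp: state_def)
  \<comment> \<open>The reference for the complete coefficient is \<open>CR\<close> as a whole. The
    marginal of \<sigma> there is the product of the marginals on \<open>C\<close> and
    \<open>R\<close>, and independence of \<open>C\<close> and \<open>R\<close> is exactly what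
    makes it agree with that of \<rho>.\<close>
  moreover have "ptrace_snd (c * r) a \<rho> = ptrace_snd (c * r) a \<sigma>"
    unfolding \<sigma>_def ptrace_snd_tensor[OF ptrace_carrier]
    using prd by (simp add: ptrace_snd_ptrace_snd ptrace_fst_ptrace_snd)
  ultimately show "(x, y) \<in> complete_pairs" using st \<sigma>s x' y' by blast
qed

lemma cq_pairs_subset_MIR: "cq_pairs n a b N \<subseteq> MIR_pairs"
proof
  fix z assume "z \<in> cq_pairs n a b N"
  then obtain r p \<rho> where z: "z = (mutual_info n (r * b) (id_tensor (n * r) a b N (cq_state n (r * a) p \<rho>)),
       mutual_info n (r * a) (cq_state n (r * a) p \<rho>))"
    and p: "prob_vec n p" and st: "\<And>u. u < n \<Longrightarrow> state (r * a) (\<rho> u)"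
    and eq: "\<And>u v. u < n \<Longrightarrow> v < n \<Longrightarrow> ptrace_snd r a (\<rho> u) = ptrace_snd r a (\<rho> v)"
    unfolding cq_pairs_def by blast
  \<comment> \<open>Weights summing to 1 rule out an empty alphabet, so index 0 can represent the
    common reference marginal below.\<close>
  have n: "0 < n" using p by (cases n) (auto simp: prob_vec_def)
  have P: "psd (r * a) (\<rho> u)" and tr: "mat_trace (\<rho> u) = 1" if "u < n" for u
    using st[OF that] by (auto simp: state_def)
  note C = psd_carrier[OF P]
  let ?M = "\<lambda>u. complex_of_real (p u) \<cdot>\<^sub>m \<rho> u"
  have cq: "cq_state n (r * a) p \<rho> = bdiag n (r * a) ?M" using C by (rule cq_state_bdiag)
  have MP: "psd (r * a) (?M u)" if "u < n" for u
    using that p P by (intro psd_smult) (auto simp: prob_vec_def)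
  have sp: "(\<Sum>u<n. complex_of_real (p u)) = 1"
    using p by (simp add: prob_vec_def flip: of_real_sum)
  have "mat_trace (bdiag n (r * a) ?M) = 1"
    using C tr sp by (simp add: mat_trace_bdiag[OF psd_carrier[OF MP]] mat_trace_smult[of _ "r * a"])
  then have s: "state (n * r * a) (bdiag n (r * a) ?M)"
    using psd_bdiag[of n "r * a" ?M, OF MP] by (simp add: state_def mult.assoc)
  define \<tau> where "\<tau> = ptrace_snd r a (\<rho> 0)"
  have \<tau>C: "\<tau> \<in> carrier_mat r r" and \<tau>t: "mat_trace \<tau> = 1"
    using mat_trace_ptrace(1)[OF C[OF n]] tr[OF n] by (simp_all add: \<tau>_def)
  let ?P = "mat_diag n (\<lambda>u. complex_of_real (p u))"
  have Pt: "mat_trace ?P = 1" using sp by (simp add: mat_trace_def mat_diag_def)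
  have "ptrace_snd (n * r) a (bdiag n (r * a) ?M) = bdiag n r (\<lambda>u. complex_of_real (p u) \<cdot>\<^sub>m \<tau>)"
    unfolding ptrace_snd_bdiag
  proof (rule bdiag_cong)
    fix u assume u: "u < n"
    have "ptrace_snd r a (\<rho> u) = \<tau>" unfolding \<tau>_def by (rule eq[OF u n])
    then show "ptrace_snd r a (?M u) = complex_of_real (p u) \<cdot>\<^sub>m \<tau>"
      by (simp add: ptrace_snd_smult[OF C[OF u]])
  qed
  also have "\<dots> = tensor_mat ?P \<tau>" by (rule tensor_mat_diag_left[OF \<tau>C, symmetric])
  finally have CR: "ptrace_snd (n * r) a (bdiag n (r * a) ?M) = tensor_mat ?P \<tau>" .
  have "1 \<cdot>\<^sub>m X = X" for X :: "complex mat" by (rule eq_matI) auto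
  then have prd: "ptrace_snd (n * r) a (bdiag n (r * a) ?M) =
      tensor_mat (ptrace_snd n r (ptrace_snd (n * r) a (bdiag n (r * a) ?M)))
        (ptrace_fst n r (ptrace_snd (n * r) a (bdiag n (r * a) ?M)))"
    unfolding CR by (simp add: ptrace_tensor[OF mat_diag_dim \<tau>C] \<tau>t Pt)
  show "z \<in> MIR_pairs"
    unfolding z cq Let_def
    by (rule CollectI, rule exI[of _ n], rule exI[of _ r], rule exI[of _ "bdiag n (r * a) ?M"])
      (intro conjI refl s prd)
qed

text \<open>Nonemptiness is asserted along with the bound, because the supremum of the empty set and
  the default value of \<open>ratio_sup\<close> differ.\<close>

lemma complete_ratio_le_binary:
  assumes q: "q \<in> ratios complete_pairs"
  shows "ratios (cq_pairs 2 a b N) \<noteq> {} \<and> q \<le> Sup (ratios (cq_pairs 2 a b N))"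
proof -
  let ?Q = "ratios (cq_pairs 2 a b N)"
  from q obtain r \<rho> \<sigma> where q: "q = rel_entropy (id_tensor r a b N \<rho>) (id_tensor r a b N \<sigma>) / rel_entropy \<rho> \<sigma>"
    and pos: "0 < rel_entropy \<rho> \<sigma>" and fin: "rel_entropy \<rho> \<sigma> < \<infinity>"
    and st: "state (r * a) \<rho>" "state (r * a) \<sigma>" and marg: "ptrace_snd r a \<rho> = ptrace_snd r a \<sigma>"
    unfolding ratios_def by blast
  have P: "psd (r * a) \<rho>" "psd (r * a) \<sigma>" using st by (auto simp: state_def)
  let ?\<rho> = "id_tensor r a b N \<rho>" and ?\<sigma> = "id_tensor r a b N \<sigma>"
  have st': "state (r * b) ?\<rho>" "state (r * b) ?\<sigma>" using st by (auto intro: state_id_tensor[OF N])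
  then have P': "psd (r * b) ?\<rho>" "psd (r * b) ?\<sigma>" by (auto simp: state_def)
  have ker: "mat_kernel \<sigma> \<subseteq> mat_kernel \<rho>" by (rule kernel_of_rel_entropy[OF P fin])
  have ker': "mat_kernel ?\<sigma> \<subseteq> mat_kernel ?\<rho>" by (rule mat_kernel_id_tensor_mono[OF N P ker])
  let ?D = "rel_ent \<rho> \<sigma>" and ?D' = "rel_ent ?\<rho> ?\<sigma>"
  \<comment> \<open>Finiteness of the denominator has given both kernel inclusions, so the numerator
    is finite as well and the ratio is one of real numbers.\<close>
  have D: "0 < ?D" and qD: "q = ereal (?D' / ?D)"
    using pos unfolding q rel_entropy_of_kernel[OF P ker] rel_entropy_of_kernel[OF P' ker']
    by (auto simp: zero_ereal_def)
  obtain I C where I: "\<And>t. 0 < t \<Longrightarrow> t < 1 \<Longrightarrow>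
      mutual_info 2 (r * a) (cq_state 2 (r * a) (binary t (1 - t)) (binary \<rho> \<sigma>)) = ereal (I t)"
    and lo: "\<And>t. 0 < t \<Longrightarrow> t < 1 \<Longrightarrow> ?D - C * t \<le> I t / t"
    and hi: "\<And>t. 0 < t \<Longrightarrow> t < 1 \<Longrightarrow> I t / t \<le> ?D"
    using mutual_info_binary_bounds[OF st ker] by blast
  obtain J K where J: "\<And>t. 0 < t \<Longrightarrow> t < 1 \<Longrightarrow>
      mutual_info 2 (r * b) (cq_state 2 (r * b) (binary t (1 - t)) (binary ?\<rho> ?\<sigma>)) = ereal (J t)"
    and lo': "\<And>t. 0 < t \<Longrightarrow> t < 1 \<Longrightarrow> ?D' - K * t \<le> J t / t"
    and hi': "\<And>t. 0 < t \<Longrightarrow> t < 1 \<Longrightarrow> J t / t \<le> ?D'"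
    using mutual_info_binary_bounds[OF st' ker'] by blast
  have limI: "((\<lambda>t. I t / t) \<longlongrightarrow> ?D) (at_right 0)"
    using lo hi by (rule tendsto_at_right_of_linear_bounds)
  have limJ: "((\<lambda>t. J t / t) \<longlongrightarrow> ?D') (at_right 0)"
    using lo' hi' by (rule tendsto_at_right_of_linear_bounds)
  \<comment> \<open>The channel acts on each conditional state separately, so the image of the
    binary mixture is the binary mixture of the images.\<close>
  have pair: "(ereal (J t), ereal (I t)) \<in> cq_pairs 2 a b N" if t: "0 < t" "t < 1" for t
  proof -
    have b: "binary ?\<rho> ?\<sigma> = (\<lambda>u. id_tensor r a b N (binary \<rho> \<sigma> u))" by (auto simp: binary_def)
    have "binary \<rho> \<sigma> u \<in> carrier_mat (r * a) (r * a)" for u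
      using P by (simp add: binary_def psd_carrier)
    then have "ereal (J t) = mutual_info 2 (r * b)
        (id_tensor (2 * r) a b N (cq_state 2 (r * a) (binary t (1 - t)) (binary \<rho> \<sigma>)))"
      using J[OF t] by (simp add: b id_tensor_cq_state[OF N])
    moreover have "prob_vec 2 (binary t (1 - t))"
      using t by (simp add: prob_vec_def binary_def numeral_2_eq_2)
    moreover have "\<forall>u<2. state (r * a) (binary \<rho> \<sigma> u)"
      "\<forall>u<2. \<forall>v<2. ptrace_snd r a (binary \<rho> \<sigma> u) = ptrace_snd r a (binary \<rho> \<sigma> v)"
      using st marg by (auto simp: binary_def)
    ultimately show ?thesis unfolding cq_pairs_def I[OF t, symmetric] by blast
  qed
  \<comment> \<open>As \<open>I t / t\<close> tends to a positive limit, the denominator is positive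
    for all small \<open>t\<close>, and the pair is admissible from then on. Numerator and
    denominator are both divided by \<open>t\<close> to match the limits.\<close>
  have mem: "\<forall>\<^sub>F t in at_right 0. ereal ((J t / t) / (I t / t)) \<in> ?Q"
  proof -
    have ev: "\<forall>\<^sub>F t in at_right (0::real). 0 < t \<and> t < 1"
      unfolding eventually_at_right_field by (intro exI[of _ 1]) auto
    from ev order_tendstoD(1)[OF limI D] show ?thesis
    proof eventually_elim
      case (elim t)
      then have "0 < I t" by (simp add: zero_less_divide_iff)
      then have "ereal (J t) / ereal (I t) \<in> ?Q"
        unfolding ratios_def using pair[of t] elim by (intro CollectI exI conjI) auto
      then show ?case using elim \<open>0 < I t\<close> by simp
    qed
  qed
  have lim: "((\<lambda>t. ereal ((J t / t) / (I t / t))) \<longlongrightarrow> q) (at_right 0)"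
    unfolding qD by (intro tendsto_intros limI limJ) (use D in auto)
  have "q \<le> Sup ?Q"
    by (rule tendsto_upperbound[OF lim _ trivial_limit_at_right_real])
      (use mem in \<open>eventually_elim, auto intro: Sup_upper\<close>)
  moreover have "?Q \<noteq> {}"
    using eventually_happens[OF mem] by auto
  ultimately show ?thesis by simp
qed

text \<open>Any set of ratios between the binary and the complete ones has the same supremum as
  both, since the supremum of the larger is at most that of the smaller.\<close>

lemma coefficients_eq:
  "eta_complete a b N = eta_2cqMIR a b N" "eta_cqMIR a b N = eta_2cqMIR a b N" "eta_MIR a b N = eta_2cqMIR a b N"
proof -
  let ?Q2 = "ratios (cq_pairs 2 a b N)" and ?Qcq = "ratios (\<Union>n. cq_pairs n a b N)"
    and ?QM = "ratios MIR_pairs" and ?Qc = "ratios complete_pairs"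
  have sub: "?Q2 \<subseteq> ?Qcq" "?Qcq \<subseteq> ?QM" "?QM \<subseteq> ?Qc"
    using cq_pairs_subset_MIR by (intro ratios_mono MIR_ratios_subset; blast)+
  have top: "Sup ?Qc \<le> Sup ?Q2" "?Q2 = {} \<Longrightarrow> ?Qc = {}"
    using complete_ratio_le_binary by (auto intro!: Sup_least)
  have eq: "ratio_sup S = ratio_sup (cq_pairs 2 a b N)" if "?Q2 \<subseteq> ratios S" "ratios S \<subseteq> ?Qc" for S
  proof (cases "?Q2 = {}")
    \<comment> \<open>Without binary ratios there are no complete ones either, so every coefficient
      in between takes the default 0.\<close>
    case True
    then show ?thesis using that top(2) by (auto simp: ratio_sup_ratios)
  next
    case False
    moreover have "Sup (ratios S) = Sup ?Q2"
      using Sup_subset_mono[OF that(1)] Sup_subset_mono[OF that(2)] top(1) by (intro antisym) auto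
    ultimately show ?thesis using that by (auto simp: ratio_sup_ratios)
  qed
  show "eta_complete a b N = eta_2cqMIR a b N" "eta_cqMIR a b N = eta_2cqMIR a b N" "eta_MIR a b N = eta_2cqMIR a b N"
    unfolding eta_complete_def eta_2cqMIR_def eta_cqMIR_def eta_MIR_def
    using sub by (auto intro!: eq)
qed

end

theorem mainTheorem4:
  fixes dA dB :: nat and N :: "complex mat \<Rightarrow> complex mat"
  assumes "channel dA dB N"
  shows "eta_complete dA dB N = eta_2cqMIR dA dB N \<and>
         eta_2cqMIR dA dB N = eta_cqMIR dA dB N \<and>
         eta_cqMIR dA dB N = eta_MIR dA dB N"
  using coefficients_eq[OF assms] by simp

end
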